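(* Let $(\Phi_n)_{n\geq0}\subset\mathcal{S}^*(M)$ be an $M$-generalized martingale. Then the following two conditions are equivalent: (1) $(\Phi_n)_{n\geq0}$ is strongly convergent in $\mathcal{S}^*(M)$; (2) there are constants $C\geq0$ and $p\geq0$ such that $$\sup_{n\geq0}|\widehat{\Phi_n}(\sigma)|\leq C\lambda_\sigma^p,\quad\sigma\in\Gamma.$$
   Context: $\mathbb{N}$ is the set of nonnegative integers and $\Gamma$ is the set of all finite subsets of $\mathbb{N}$. $(\Omega,\mathcal{F},P)$ is a probability space with expectation $\mathbb{E}$. A discrete-time normal martingale is a real-valued square integrable process $M=(M_n)_{n\in\mathbb{N}}$ on it such that $\mathbb{E}[M_0|\mathcal{F}_{-1}]=0$, $\mathbb{E}[M_n|\mathcal{F}_{n-1}]=M_{n-1}$ for $n\ge1$, $\mathbb{E}[M_0^2|\mathcal{F}_{-1}]=1$ and $\mathbb{E}[M_n^2|\mathcal{F}_{n-1}]=M_{n-1}^2+1$ for $n\ge1$, where $\mathcal{F}_{-1}=\{\emptyset,\Omega\}$ and $\mathcal{F}_n=\sigma(M_k;0\le k\le n)$. Its associated discrete-time normal noise is $Z_0=M_0$, $Z_n=M_n-M_{n-1}$ ($n\ge 1$). Put $Z_\emptyset=1$ and $Z_\sigma=\prod_{i\in\sigma}Z_i$ for nonempty $\sigma\in\Gamma$. Let $\mathcal{F}_\infty=\sigma(M_n;n\in\mathbb{N})$ and let $\mathcal{L}^2(M)=\mathcal{L}^2(\Omega,\mathcal{F}_\infty,P)$ be the complex Hilbert space with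 inner product $\langle\cdot,\cdot\rangle$ (conjugate-linear in the first argument, linear in the second) and norm $\|\cdot\|$. $M$ has the chaotic representation property if $\{Z_\sigma\mid\sigma\in\Gamma\}$ is total in $\mathcal{L}^2(M)$. Standing assumption: $M$ is a discrete-time normal martingale with the chaotic representation property; then $\{Z_\sigma\mid\sigma\in\Gamma\}$ is an orthonormal basis of $\mathcal{L}^2(M)$. Let $\lambda_\emptyset=1$ and $\lambda_\sigma=\prod_{k\in\sigma}(k+1)$ for nonempty $\sigma\in\Gamma$. For $p\ge0$ put $\|\xi\|_p^2=\sum_{\sigma\in\Gamma}\lambda_\sigma^{2p}|\langle Z_\sigma,\xi\rangle|^2$ and $\mathcal{S}_p(M)=\{\xi\in\mathcal{L}^2(M)\mid\|\xi\|_p<\infty\}$, a Hilbert space with norm $\|\cdot\|_p$. Let $\mathcal{S}(M)=\bigcap_{p=0}^\infty\mathcal{S}_p(M)$ with the topology generated by the norms $\{\|\cdot\|_p\}_{p\ge0}$; it contains all $Z_\sigma$. $\mathcal{S}^*(M)$ is the topological dual of $\mathcal{S}(M)$; its elements are called generalized functionals of $M$. The canonical bilinear form is $\langle\!\langle\Phi,\xi\rangle\!\rangle=\Phi(\xi)$ for $\Phi\in\mathcal{S}^*(M)$, $\xi\in\mathcal{S}(M)$. Strong convergence in $\mathcal{S}^*(M)$ means convergence (to some element of $\mathcal{S}^*(M)$) in the strong topology (uniform convergence on bounded subsets of $\mathcal{S}(M)$). The Fock transform of $\Phi\in\mathcal{S}^*(M)$ is the function $\widehat{\Phi}$ on $\Gamma$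 given by $\widehat{\Phi}(\sigma)=\langle\!\langle\Phi,Z_\sigma\rangle\!\rangle$. For $n\ge0$, $\Gamma_{n]}$ is the power set of $\{0,1,\dots,n\}$ and $\mathbf{I}_{n]}$ is its indicator function on $\Gamma$. A sequence $(\Phi_n)_{n\ge0}\subset\mathcal{S}^*(M)$ is called an $M$-generalized martingale if $\widehat{\Phi_n}(\sigma)=\mathbf{I}_{n]}(\sigma)\widehat{\Phi_{n+1}}(\sigma)$ for all $\sigma\in\Gamma$ and $n\ge0$. *)

theory Defs
  imports "HOL-Probability.Probability"
begin

text \<open>
  A process \<open>M\<close> on a probability space \<open>P\<close> is a function \<open>nat \<Rightarrow> 'a \<Rightarrow> real\<close>.
  \<open>sigma_of P M {..n}\<close> is the sigma-algebra of the first \<open>n + 1\<close> variables; in particular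
  \<open>sigma_of P M {}\<close> is trivial and plays the role of the sigma-algebra with index \<open>-1\<close>.
\<close>

definition sigma_of :: "'a measure \<Rightarrow> (nat \<Rightarrow> 'a \<Rightarrow> real) \<Rightarrow> nat set \<Rightarrow> 'a measure" where
  "sigma_of P M I = sigma (space P) {M k -` A \<inter> space P |k A. k \<in> I \<and> A \<in> sets borel}"

definition normal_martingale :: "'a measure \<Rightarrow> (nat \<Rightarrow> 'a \<Rightarrow> real) \<Rightarrow> bool" where
  "normal_martingale P M \<longleftrightarrow>
     (\<forall>n. M n \<in> borel_measurable P \<and> integrable P (\<lambda>\<omega>. (M n \<omega>)\<^sup>2)) \<and>
     (AE \<omega> in P. real_cond_exp P (sigma_of P M {}) (M 0) \<omega> = 0) \<and>
     (\<forall>n. AE \<omega> in P. real_cond_exp P (sigma_of P M {..n}) (M (Suc n)) \<omega> = M n \<omega>) \<and>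
     (AE \<omega> in P. real_cond_exp P (sigma_of P M {}) (\<lambda>\<omega>. (M 0 \<omega>)\<^sup>2) \<omega> = 1) \<and>
     (\<forall>n. AE \<omega> in P.
        real_cond_exp P (sigma_of P M {..n}) (\<lambda>\<omega>. (M (Suc n) \<omega>)\<^sup>2) \<omega> = (M n \<omega>)\<^sup>2 + 1)"

fun noise :: "(nat \<Rightarrow> 'a \<Rightarrow> real) \<Rightarrow> nat \<Rightarrow> 'a \<Rightarrow> real" where
  "noise M 0 = M 0"
| "noise M (Suc n) = (\<lambda>\<omega>. M (Suc n) \<omega> - M n \<omega>)"

definition Fin_Sets :: "nat set set" where
  "Fin_Sets = {\<sigma>. finite \<sigma>}"

definition noise_prod :: "(nat \<Rightarrow> 'a \<Rightarrow> real) \<Rightarrow> nat set \<Rightarrow> 'a \<Rightarrow> complex" where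
  "noise_prod M \<sigma> = (\<lambda>\<omega>. complex_of_real (\<Prod>i\<in>\<sigma>. noise M i \<omega>))"

text \<open>
  Elements of the Hilbert space are represented by square integrable functions; two functions
  that agree almost everywhere represent the same element and have distance 0. Hence all norms
  below are seminorms on functions, and a functional that is continuous for them depends only
  on the almost-everywhere class of its argument.
\<close>

definition L2 :: "'a measure \<Rightarrow> (nat \<Rightarrow> 'a \<Rightarrow> real) \<Rightarrow> ('a \<Rightarrow> complex) set" where
  "L2 P M = {\<xi> \<in> borel_measurable (sigma_of P M UNIV). integrable P (\<lambda>\<omega>. (cmod (\<xi> \<omega>))\<^sup>2)}"

definition l2_inner :: "'a measure \<Rightarrow> ('a \<Rightarrow> complex) \<Rightarrow> ('a \<Rightarrow> complex) \<Rightarrow> complex" where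
  "l2_inner P \<xi> \<eta> = (\<integral>\<omega>. cnj (\<xi> \<omega>) * \<eta> \<omega> \<partial>P)"

definition l2_norm :: "'a measure \<Rightarrow> ('a \<Rightarrow> complex) \<Rightarrow> real" where
  "l2_norm P \<xi> = sqrt (\<integral>\<omega>. (cmod (\<xi> \<omega>))\<^sup>2 \<partial>P)"

text \<open>Totality: the finite complex linear combinations of the \<open>noise_prod M \<sigma>\<close> are dense.\<close>

definition chaotic_representation :: "'a measure \<Rightarrow> (nat \<Rightarrow> 'a \<Rightarrow> real) \<Rightarrow> bool" where
  "chaotic_representation P M \<longleftrightarrow>
     (\<forall>\<xi>\<in>L2 P M. \<forall>\<epsilon>>0. \<exists>A c. finite A \<and> A \<subseteq> Fin_Sets \<and>
        l2_norm P (\<lambda>\<omega>. \<xi> \<omega> - (\<Sum>\<sigma>\<in>A. c \<sigma> * noise_prod M \<sigma> \<omega>)) < \<epsilon>)"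

definition weight :: "nat set \<Rightarrow> real" where
  "weight \<sigma> = (\<Prod>k\<in>\<sigma>. real k + 1)"

definition Sp :: "'a measure \<Rightarrow> (nat \<Rightarrow> 'a \<Rightarrow> real) \<Rightarrow> real \<Rightarrow> ('a \<Rightarrow> complex) set" where
  "Sp P M p = {\<xi> \<in> L2 P M.
     (\<lambda>\<sigma>. weight \<sigma> powr (2 * p) * (cmod (l2_inner P (noise_prod M \<sigma>) \<xi>))\<^sup>2) summable_on Fin_Sets}"

text \<open>Only meaningful on \<open>Sp P M p\<close>: elsewhere the divergent sum has the default value 0.\<close>

definition p_norm :: "'a measure \<Rightarrow> (nat \<Rightarrow> 'a \<Rightarrow> real) \<Rightarrow> real \<Rightarrow> ('a \<Rightarrow> complex) \<Rightarrow> real" where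
  "p_norm P M p \<xi> =
     sqrt (\<Sum>\<^sub>\<infinity>\<sigma>\<in>Fin_Sets. weight \<sigma> powr (2 * p) * (cmod (l2_inner P (noise_prod M \<sigma>) \<xi>))\<^sup>2)"

definition S_space :: "'a measure \<Rightarrow> (nat \<Rightarrow> 'a \<Rightarrow> real) \<Rightarrow> ('a \<Rightarrow> complex) set" where
  "S_space P M = (\<Inter>p::nat. Sp P M (real p))"

text \<open>
  The topology on \<open>V\<close> generated by the balls of a family of pseudometrics; a ball is the set of
  points at distance less than its radius. Infinite distances are permitted.
\<close>

definition family_topology ::
    "'v set \<Rightarrow> 'i set \<Rightarrow> ('i \<Rightarrow> 'v \<Rightarrow> 'v \<Rightarrow> ennreal) \<Rightarrow> 'v topology" where
  "family_topology V I d =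
     topology_generated_by {{y \<in> V. d i x y < ennreal \<epsilon>} |i x \<epsilon>. i \<in> I \<and> x \<in> V \<and> 0 < \<epsilon>}"

definition S_topology :: "'a measure \<Rightarrow> (nat \<Rightarrow> 'a \<Rightarrow> real) \<Rightarrow> ('a \<Rightarrow> complex) topology" where
  "S_topology P M =
     family_topology (S_space P M) {p. 0 \<le> p} (\<lambda>p \<xi> \<eta>. ennreal (p_norm P M p (\<lambda>\<omega>. \<xi> \<omega> - \<eta> \<omega>)))"

text \<open>
  The generalized functionals: the topological dual of \<open>S_space P M\<close>. Membership in \<open>extensional\<close> fixes
  the irrelevant values outside \<open>S_space P M\<close>, so that functionals equal on \<open>S_space P M\<close> are equal.
\<close>

definition S_dual ::
    "'a measure \<Rightarrow> (nat \<Rightarrow> 'a \<Rightarrow> real) \<Rightarrow> (('a \<Rightarrow> complex) \<Rightarrow> complex) set" where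
  "S_dual P M = {\<Phi> \<in> extensional (S_space P M).
     (\<forall>\<xi>\<in>S_space P M. \<forall>\<eta>\<in>S_space P M. \<forall>a b. \<Phi> (\<lambda>\<omega>. a * \<xi> \<omega> + b * \<eta> \<omega>) = a * \<Phi> \<xi> + b * \<Phi> \<eta>) \<and>
     continuous_map (S_topology P M) euclidean \<Phi>}"

definition S_bounded :: "'a measure \<Rightarrow> (nat \<Rightarrow> 'a \<Rightarrow> real) \<Rightarrow> ('a \<Rightarrow> complex) set \<Rightarrow> bool" where
  "S_bounded P M B \<longleftrightarrow> B \<subseteq> S_space P M \<and> (\<forall>p\<ge>0. \<exists>K. \<forall>\<xi>\<in>B. p_norm P M p \<xi> \<le> K)"

definition strong_topology ::
    "'a measure \<Rightarrow> (nat \<Rightarrow> 'a \<Rightarrow> real) \<Rightarrow> (('a \<Rightarrow> complex) \<Rightarrow> complex) topology" where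
  "strong_topology P M =
     family_topology (S_dual P M) {B. S_bounded P M B}
       (\<lambda>B \<Phi> \<Psi>. SUP \<xi>\<in>B. ennreal (cmod (\<Phi> \<xi> - \<Psi> \<xi>)))"

definition strongly_convergent ::
    "'a measure \<Rightarrow> (nat \<Rightarrow> 'a \<Rightarrow> real) \<Rightarrow> (nat \<Rightarrow> ('a \<Rightarrow> complex) \<Rightarrow> complex) \<Rightarrow> bool" where
  "strongly_convergent P M \<Phi> \<longleftrightarrow>
     (\<exists>\<Psi>\<in>S_dual P M. limitin (strong_topology P M) \<Phi> \<Psi> sequentially)"

definition fock_transform ::
    "(nat \<Rightarrow> 'a \<Rightarrow> real) \<Rightarrow> (('a \<Rightarrow> complex) \<Rightarrow> complex) \<Rightarrow> nat set \<Rightarrow> complex" where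
  "fock_transform M \<Phi> \<sigma> = \<Phi> (noise_prod M \<sigma>)"

definition generalized_martingale ::
    "'a measure \<Rightarrow> (nat \<Rightarrow> 'a \<Rightarrow> real) \<Rightarrow> (nat \<Rightarrow> ('a \<Rightarrow> complex) \<Rightarrow> complex) \<Rightarrow> bool" where
  "generalized_martingale P M \<Phi> \<longleftrightarrow>
     (\<forall>n. \<Phi> n \<in> S_dual P M) \<and>
     (\<forall>n. \<forall>\<sigma>\<in>Fin_Sets.
        fock_transform M (\<Phi> n) \<sigma> = indicator (Pow {0..n}) \<sigma> * fock_transform M (\<Phi> (Suc n)) \<sigma>)"

end

theory Submission
  imports Defs
begin

text \<open>
  By orthonormality of the \<open>noise_prod M \<sigma>\<close> every \<open>\<xi>\<close> in \<open>S_space P M\<close> is the limit, in each norm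
  \<open>p_norm P M p\<close>, of its finite Fourier sums, so a generalized functional acts by
  \<open>\<Phi> \<xi> = (\<Sum>\<sigma>. \<langle>Z\<^sub>\<sigma>, \<xi>\<rangle> * fock_transform M \<Phi> \<sigma>)\<close>.
  Along a generalized martingale the Fock transforms are truncations to subsets of \<open>{0..n}\<close> of a
  single function \<open>F\<close>. If the martingale converges, \<open>F\<close> is the Fock transform of the limit, and
  continuity of the limit bounds it by a power of the weight. Conversely, if \<open>F\<close> has such a bound,
  it defines the limit, and the difference to the \<open>n\<close>-th term is a tail that Cauchy-Schwarz
  controls uniformly on bounded sets, since \<open>(\<Sum>\<sigma>. (weight \<sigma>)\<^sup>-\<^sup>2) = (\<Prod>k. 1 + 1 / (k + 1)\<^sup>2)\<close> is finite.
\<close>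

section \<open>Topologies of pseudometric families\<close>

text \<open>The generating balls are only a subbasis and have arbitrary centres. By the triangle
  inequality a ball that contains \<open>x\<close> contains a smaller ball around \<open>x\<close>
  for the same pseudometric; an intersection merges the two finite index sets and keeps the smaller
  radius.\<close>

lemma openin_family_topologyD:
  assumes tri: "\<And>i x y z. i \<in> I \<Longrightarrow> x \<in> V \<Longrightarrow> y \<in> V \<Longrightarrow> z \<in> V \<Longrightarrow> d i x z \<le> d i x y + d i y z"
    and U: "openin (family_topology V I d) U" and x: "x \<in> U" "x \<in> V"
  shows "\<exists>J \<delta>. finite J \<and> J \<subseteq> I \<and> 0 < \<delta> \<and> (\<forall>y\<in>V. (\<forall>i\<in>J. d i x y < ennreal \<delta>) \<longrightarrow> y \<in> U)"
proof -
  have "generate_topology_on {{y \<in> V. d i x y < ennreal \<epsilon>} |i x \<epsilon>. i \<in> I \<and> x \<in> V \<and> 0 < \<epsilon>} U"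
    using U unfolding family_topology_def openin_topology_generated_by_iff .
  then show ?thesis using x
  proof (induction rule: generate_topology_on.induct)
    case Empty
    then show ?case by simp
  next
    case (Int A B)
    obtain J1 \<delta>1 where
      1: "finite J1" "J1 \<subseteq> I" "0 < \<delta>1" "\<And>y. y \<in> V \<Longrightarrow> \<forall>i\<in>J1. d i x y < ennreal \<delta>1 \<Longrightarrow> y \<in> A"
      using Int.IH(1) Int.prems by blast
    obtain J2 \<delta>2 where
      2: "finite J2" "J2 \<subseteq> I" "0 < \<delta>2" "\<And>y. y \<in> V \<Longrightarrow> \<forall>i\<in>J2. d i x y < ennreal \<delta>2 \<Longrightarrow> y \<in> B"
      using Int.IH(2) Int.prems by blast
    have "ennreal (min \<delta>1 \<delta>2) \<le> ennreal \<delta>1" "ennreal (min \<delta>1 \<delta>2) \<le> ennreal \<delta>2"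
      by (auto intro: ennreal_leI)
    then have "y \<in> A \<inter> B" if "y \<in> V" "\<forall>i\<in>J1 \<union> J2. d i x y < ennreal (min \<delta>1 \<delta>2)" for y
      using that 1(4)[of y] 2(4)[of y] by (meson IntI UnI1 UnI2 order_less_le_trans)
    with 1 2 show ?case
      by (intro exI[of _ "J1 \<union> J2"] exI[of _ "min \<delta>1 \<delta>2"]) auto
  next
    case (UN K)
    then show ?case by (meson Union_iff)
  next
    case (Basis s)
    then obtain i c \<epsilon> where s: "s = {y \<in> V. d i c y < ennreal \<epsilon>}" and i: "i \<in> I" "c \<in> V" "0 < \<epsilon>"
      by blast
    with Basis.prems have "d i c x < ennreal \<epsilon>" by auto
    \<comment> \<open>A distance below \<open>ennreal \<epsilon>\<close> is finite, hence a real
      \<open>r\<close>, and \<open>\<epsilon> - r\<close> is the radius left over around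
      \<open>x\<close>.\<close>
    then obtain r where r: "d i c x = ennreal r" "0 \<le> r" "r < \<epsilon>"
      by (metis ennreal_cases ennreal_less_iff not_less_iff_gr_or_eq top.not_eq_extremum)
    have "y \<in> s" if y: "y \<in> V" "d i x y < ennreal (\<epsilon> - r)" for y
    proof -
      obtain t where t: "d i x y = ennreal t" "0 \<le> t" "t < \<epsilon> - r"
        using y(2) by (metis ennreal_cases ennreal_less_iff not_less_iff_gr_or_eq top.not_eq_extremum)
      have "d i c y \<le> ennreal (r + t)"
        using tri[OF i(1,2) Basis.prems(2) y(1)] r t by (simp add: ennreal_plus)
      also have "\<dots> < ennreal \<epsilon>"
        using r t i by (simp add: ennreal_less_iff del: ennreal_plus)
      finally show ?thesis using s y by simp
    qed
    with r i show ?case by (intro exI[of _ "{i}"] exI[of _ "\<epsilon> - r"]) auto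
  qed
qed

lemma openin_family_topology_ball:
  assumes "i \<in> I" "x \<in> V" "0 < \<epsilon>"
  shows "openin (family_topology V I d) {y \<in> V. d i x y < ennreal \<epsilon>}"
  unfolding family_topology_def
  by (rule topology_generated_by_Basis) (use assms in blast)

text \<open>Each point lies in its own ball of radius 1. The index \<open>i\<close> guarantees that
  there are balls at all.\<close>

lemma topspace_family_topology:
  assumes "i \<in> I" and "\<And>x. x \<in> V \<Longrightarrow> d i x x = 0"
  shows "topspace (family_topology V I d) = V"
proof -
  have "x \<in> \<Union>{{y \<in> V. d i x y < ennreal \<epsilon>} |i x \<epsilon>. i \<in> I \<and> x \<in> V \<and> 0 < \<epsilon>}" if "x \<in> V" for x
  proof (rule UnionI)
    show "{y \<in> V. d i x y < ennreal 1} \<in> {{y \<in> V. d i x y < ennreal \<epsilon>} |i x \<epsilon>. i \<in> I \<and> x \<in> V \<and> 0 < \<epsilon>}"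
      using assms(1) that zero_less_one by blast
  qed (use assms that in simp)
  then show ?thesis
    unfolding family_topology_def topology_generated_by_topspace by auto
qed

section \<open>Square summable families\<close>

text \<open>Minkowski's inequality for infinite families: \<open>L2_set\<close> gives it on every
  finite subset with a bound independent of the subset, and nonnegative sums are controlled by their
  finite partial sums.\<close>

lemma square_summable_add:
  fixes f g :: "'b \<Rightarrow> real"
  assumes f: "(\<lambda>i. (f i)\<^sup>2) summable_on A" and g: "(\<lambda>i. (g i)\<^sup>2) summable_on A"
  shows "(\<lambda>i. (f i + g i)\<^sup>2) summable_on A"
    and "sqrt (\<Sum>\<^sub>\<infinity>i\<in>A. (f i + g i)\<^sup>2) \<le> sqrt (\<Sum>\<^sub>\<infinity>i\<in>A. (f i)\<^sup>2) + sqrt (\<Sum>\<^sub>\<infinity>i\<in>A. (g i)\<^sup>2)"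
proof -
  let ?b = "sqrt (\<Sum>\<^sub>\<infinity>i\<in>A. (f i)\<^sup>2) + sqrt (\<Sum>\<^sub>\<infinity>i\<in>A. (g i)\<^sup>2)"
  have b: "0 \<le> ?b" by (simp add: infsum_nonneg)
  have fin: "(\<Sum>i\<in>F. (f i + g i)\<^sup>2) \<le> ?b\<^sup>2" if F: "finite F" "F \<subseteq> A" for F
  proof -
    have "L2_set (\<lambda>i. f i + g i) F \<le> L2_set f F + L2_set g F"
      by (rule L2_set_triangle_ineq)
    also have "\<dots> \<le> ?b"
      unfolding L2_set_def using F f g
      by (intro add_mono real_sqrt_le_mono finite_sum_le_infsum) auto
    finally have "sqrt (\<Sum>i\<in>F. (f i + g i)\<^sup>2) \<le> ?b" by (simp add: L2_set_def)
    then show ?thesis by (rule sqrt_le_D)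
  qed
  show summ: "(\<lambda>i. (f i + g i)\<^sup>2) summable_on A"
    by (rule nonneg_bdd_above_summable_on) (auto intro!: bdd_aboveI2[where M = "?b\<^sup>2"] fin)
  have "(\<Sum>\<^sub>\<infinity>i\<in>A. (f i + g i)\<^sup>2) \<le> ?b\<^sup>2"
    by (rule infsum_le_finite_sums[OF summ fin])
  then show "sqrt (\<Sum>\<^sub>\<infinity>i\<in>A. (f i + g i)\<^sup>2) \<le> ?b"
    using b real_le_lsqrt by blast
qed

text \<open>Cauchy-Schwarz for infinite families, by the same passage from finite subsets.\<close>

lemma square_summable_mult:
  fixes f g :: "'b \<Rightarrow> real"
  assumes f: "(\<lambda>i. (f i)\<^sup>2) summable_on A" and g: "(\<lambda>i. (g i)\<^sup>2) summable_on A"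
  shows "(\<lambda>i. \<bar>f i\<bar> * \<bar>g i\<bar>) summable_on A"
    and "(\<Sum>\<^sub>\<infinity>i\<in>A. \<bar>f i\<bar> * \<bar>g i\<bar>) \<le> sqrt (\<Sum>\<^sub>\<infinity>i\<in>A. (f i)\<^sup>2) * sqrt (\<Sum>\<^sub>\<infinity>i\<in>A. (g i)\<^sup>2)"
proof -
  let ?b = "sqrt (\<Sum>\<^sub>\<infinity>i\<in>A. (f i)\<^sup>2) * sqrt (\<Sum>\<^sub>\<infinity>i\<in>A. (g i)\<^sup>2)"
  have fin: "(\<Sum>i\<in>F. \<bar>f i\<bar> * \<bar>g i\<bar>) \<le> ?b" if F: "finite F" "F \<subseteq> A" for F
  proof -
    have "(\<Sum>i\<in>F. \<bar>f i\<bar> * \<bar>g i\<bar>) \<le> L2_set f F * L2_set g F"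
      by (rule L2_set_mult_ineq)
    also have "\<dots> \<le> ?b"
      unfolding L2_set_def using F f g
      by (intro mult_mono real_sqrt_le_mono finite_sum_le_infsum) (auto simp: infsum_nonneg sum_nonneg)
    finally show ?thesis .
  qed
  show summ: "(\<lambda>i. \<bar>f i\<bar> * \<bar>g i\<bar>) summable_on A"
    by (rule nonneg_bdd_above_summable_on) (auto intro!: bdd_aboveI2[where M = ?b] fin)
  show "(\<Sum>\<^sub>\<infinity>i\<in>A. \<bar>f i\<bar> * \<bar>g i\<bar>) \<le> ?b"
    by (rule infsum_le_finite_sums[OF summ fin])
qed

text \<open>For finite \<open>F\<close> the tail outside \<open>F\<close> is the total minus the
  partial sum over \<open>F\<close>, and the partial sums converge to the total.\<close>

lemma infsum_Diff_tendsto_0: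
  fixes f :: "'b \<Rightarrow> real"
  assumes "f summable_on A"
  shows "((\<lambda>F. infsum f (A - F)) \<longlongrightarrow> 0) (finite_subsets_at_top A)"
proof -
  have "((\<lambda>F. infsum f A - sum f F) \<longlongrightarrow> infsum f A - infsum f A) (finite_subsets_at_top A)"
    using has_sum_infsum[OF assms] unfolding has_sum_def by (intro tendsto_intros)
  moreover have "eventually (\<lambda>F. infsum f A - sum f F = infsum f (A - F)) (finite_subsets_at_top A)"
    by (rule eventually_finite_subsets_at_top_weakI) (simp add: assms infsum_Diff)
  ultimately show ?thesis by (simp add: tendsto_cong)
qed

lemma integrable_mult_of_squares:
  fixes f g :: "'a \<Rightarrow> real"
  assumes [measurable]: "f \<in> borel_measurable N" "g \<in> borel_measurable N"
    and "integrable N (\<lambda>x. (f x)\<^sup>2)" "integrable N (\<lambda>x. (g x)\<^sup>2)"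
  shows "integrable N (\<lambda>x. f x * g x)"
proof (rule Bochner_Integration.integrable_bound)
  show "integrable N (\<lambda>x. (f x)\<^sup>2 + (g x)\<^sup>2)" using assms by simp
  have "\<bar>a * b\<bar> \<le> a\<^sup>2 + b\<^sup>2" for a b :: real
    using sum_squares_bound[of "\<bar>a\<bar>" "\<bar>b\<bar>"] mult_nonneg_nonneg[of "\<bar>a\<bar>" "\<bar>b\<bar>"]
    by (simp add: abs_mult del: mult_nonneg_nonneg)
  then show "AE x in N. norm (f x * g x) \<le> norm ((f x)\<^sup>2 + (g x)\<^sup>2)" by simp
qed measurable

section \<open>Square summability of the inverse weights\<close>

lemma weight_ge_1: "1 \<le> weight \<sigma>"
  unfolding weight_def by (rule prod_ge_1) simp

lemma weight_pos: "0 < weight \<sigma>"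
  using weight_ge_1[of \<sigma>] by linarith

text \<open>A finite family of finite sets lies in the power set of some \<open>{..<n}\<close>. Over
  that power set the sum factorizes, and \<open>1 + x \<le> exp x\<close> bounds the product by the
  exponential of a convergent series, uniformly in \<open>n\<close>.\<close>

lemma weight_square_inverse_summable: "(\<lambda>\<sigma>. (inverse (weight \<sigma>))\<^sup>2) summable_on Fin_Sets"
proof (rule nonneg_bdd_above_summable_on)
  have "(\<Sum>\<sigma>\<in>F. (inverse (weight \<sigma>))\<^sup>2) \<le> exp (pi\<^sup>2 / 6)" if F: "F \<subseteq> Fin_Sets" "finite F" for F
  proof -
    have "finite (\<Union>F)" using F by (auto simp: Fin_Sets_def)
    then obtain n where n: "\<Union>F \<subseteq> {..<n}" by (meson finite_nat_iff_bounded)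
    have "(\<Sum>\<sigma>\<in>F. (inverse (weight \<sigma>))\<^sup>2) \<le> (\<Sum>\<sigma>\<in>Pow {..<n}. (inverse (weight \<sigma>))\<^sup>2)"
      by (rule sum_mono2) (use n in auto)
    also have "\<dots> = (\<Sum>\<sigma>\<in>Pow {..<n}. \<Prod>k\<in>\<sigma>. 1 / (real k + 1)\<^sup>2)"
      by (simp add: weight_def prod_inversef[symmetric] prod_power_distrib power_inverse inverse_eq_divide
          prod_dividef power_one_over)
    \<comment> \<open>Expanding the product chooses for each \<open>k < n\<close> either the
      reciprocal square or 1; these choices are the subsets of \<open>{..<n}\<close>.\<close>
    also have "\<dots> = (\<Prod>k<n. 1 / (real k + 1)\<^sup>2 + 1)"
      by (simp add: prod_add)
    also have "\<dots> \<le> (\<Prod>k<n. exp (1 / (real k + 1)\<^sup>2))"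
      by (rule prod_mono) (auto simp: add.commute intro: exp_ge_add_one_self)
    also have "\<dots> = exp (\<Sum>k<n. 1 / (real k + 1)\<^sup>2)"
      by (simp add: exp_sum)
    also have "\<dots> \<le> exp (pi\<^sup>2 / 6)"
      using sum_le_suminf[OF sums_summable[OF inverse_squares_sums], of "{..<n}"]
        sums_unique[OF inverse_squares_sums] by (simp add: add.commute)
    finally show ?thesis .
  qed
  then show "bdd_above (sum (\<lambda>\<sigma>. (inverse (weight \<sigma>))\<^sup>2) ` {F. F \<subseteq> Fin_Sets \<and> finite F})"
    by (intro bdd_aboveI2[where M = "exp (pi\<^sup>2 / 6)"]) auto
qed simp

section \<open>Orthonormality of the products of the noise\<close>

locale normal_martingale_space = prob_space P for P :: "'a measure" +
  fixes M :: "nat \<Rightarrow> 'a \<Rightarrow> real"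
  assumes normal: "normal_martingale P M"
begin

text \<open>The information strictly before time \<open>n\<close>. For \<open>n = 0\<close> it is
  generated by no variable, hence trivial, so that the first noise variable and the later ones can
  be treated alike.\<close>

abbreviation "past n \<equiv> sigma_of P M {..<n}"
abbreviation "Z \<equiv> noise M"
abbreviation "coef \<sigma> \<xi> \<equiv> l2_inner P (noise_prod M \<sigma>) \<xi>"

lemma M_measurable [measurable]: "M n \<in> borel_measurable P"
  and M_square_integrable: "integrable P (\<lambda>\<omega>. (M n \<omega>)\<^sup>2)"
  using normal by (auto simp: normal_martingale_def)

lemma M_integrable: "integrable P (M n)"
  using integrable_mult_of_squares[of "M n" P "\<lambda>_. 1"] M_square_integrable[of n] by simp

lemma space_sigma_of [simp]: "space (sigma_of P M I) = space P"
  by (simp add: sigma_of_def space_measure_of_conv)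

lemma sets_sigma_of:
  "sets (sigma_of P M I) =
     sigma_sets (space P) {M k -` A \<inter> space P |k A. k \<in> I \<and> A \<in> sets borel}"
  unfolding sigma_of_def by (rule sets_measure_of) auto

lemma subalgebra_sigma_of: "subalgebra P (sigma_of P M I)"
proof -
  have "{M k -` A \<inter> space P |k A. k \<in> I \<and> A \<in> sets borel} \<subseteq> sets P"
    by (auto intro: measurable_sets[OF M_measurable])
  then show ?thesis
    by (simp add: subalgebra_def sets_sigma_of sets.sigma_sets_subset)
qed

lemma M_measurable_sigma_of: "k \<in> I \<Longrightarrow> M k \<in> borel_measurable (sigma_of P M I)"
  by (rule measurableI) (auto simp: sets_sigma_of intro!: sigma_sets.Basic)

lemma sigma_finite_subalgebra_sigma_of: "sigma_finite_subalgebra P (sigma_of P M I)"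
  by (rule finite_measure_subalgebra_is_sigma_finite, unfold_locales) (rule subalgebra_sigma_of)

lemma noise_measurable_sigma_of: "{..n} \<subseteq> I \<Longrightarrow> Z n \<in> borel_measurable (sigma_of P M I)"
  by (cases n) (auto intro!: borel_measurable_diff M_measurable_sigma_of)

lemma noise_measurable [measurable]: "Z n \<in> borel_measurable P"
  using measurable_from_subalg[OF subalgebra_sigma_of noise_measurable_sigma_of[OF order_refl]] .

section \<open>Moments of the noise, conditional on the past\<close>

lemma noise_square_integrable: "integrable P (\<lambda>\<omega>. (Z n \<omega>)\<^sup>2)"
proof (cases n)
  case (Suc m)
  have "integrable P (\<lambda>\<omega>. (M n \<omega>)\<^sup>2 + (M m \<omega>)\<^sup>2 - 2 * (M n \<omega> * M m \<omega>))"
    by (intro Bochner_Integration.integrable_diff Bochner_Integration.integrable_add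
        integrable_mult_right integrable_mult_of_squares M_square_integrable M_measurable)
  then show ?thesis by (simp add: Suc power2_diff algebra_simps)
qed (simp add: M_square_integrable)

text \<open>For \<open>n = Suc m\<close> the variable \<open>M m\<close> is measurable with respect
  to \<open>past n\<close>, so it is its own conditional expectation and cancels against that of
  \<open>M n\<close>.\<close>

lemma cond_exp_noise: "AE \<omega> in P. real_cond_exp P (past n) (Z n) \<omega> = 0"
proof (cases n)
  case 0
  then show ?thesis using normal by (simp add: normal_martingale_def)
next
  case (Suc m)
  interpret sigma_finite_subalgebra P "past n" by (rule sigma_finite_subalgebra_sigma_of)
  have "AE \<omega> in P. real_cond_exp P (past n) (M n) \<omega> = M m \<omega>"
    using normal by (simp add: normal_martingale_def Suc lessThan_Suc_atMost)
  moreover have "AE \<omega> in P. real_cond_exp P (past n) (M m) \<omega> = M m \<omega>"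
    by (rule real_cond_exp_F_meas) (auto simp: Suc intro: M_integrable M_measurable_sigma_of)
  moreover have "AE \<omega> in P. real_cond_exp P (past n) (\<lambda>\<omega>. M n \<omega> - M m \<omega>) \<omega> =
      real_cond_exp P (past n) (M n) \<omega> - real_cond_exp P (past n) (M m) \<omega>"
    by (rule real_cond_exp_diff) (rule M_integrable)+
  ultimately show ?thesis unfolding Suc noise.simps by eventually_elim simp
qed

text \<open>For \<open>n = Suc m\<close> the square is the difference of the squares of
  \<open>M n\<close> and \<open>M m\<close> minus \<open>2 * (M m * Z n)\<close>. The difference of
  squares contributes 1. In the last term \<open>M m\<close> is pulled out of the conditional
  expectation, and the remaining factor has conditional mean 0.\<close>

lemma cond_exp_noise_square: "AE \<omega> in P. real_cond_exp P (past n) (\<lambda>\<omega>. (Z n \<omega>)\<^sup>2) \<omega> = 1"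
proof (cases n)
  case 0
  then show ?thesis using normal by (simp add: normal_martingale_def)
next
  case (Suc m)
  interpret sigma_finite_subalgebra P "past n" by (rule sigma_finite_subalgebra_sigma_of)
  let ?E = "real_cond_exp P (past n)"
  have Mm: "M m \<in> borel_measurable (past n)" by (simp add: Suc M_measurable_sigma_of)
  have int: "integrable P (\<lambda>\<omega>. M m \<omega> * M n \<omega>)" "integrable P (\<lambda>\<omega>. M m \<omega> * Z n \<omega>)"
    by (auto intro!: integrable_mult_of_squares M_square_integrable noise_square_integrable
        simp del: noise.simps)
  have eq: "(\<lambda>\<omega>. (Z n \<omega>)\<^sup>2) = (\<lambda>\<omega>. ((M n \<omega>)\<^sup>2 - (M m \<omega>)\<^sup>2) - 2 * (M m \<omega> * Z n \<omega>))"
    by (auto simp: Suc power2_eq_square algebra_simps)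
  have "AE \<omega> in P. ?E (\<lambda>\<omega>. (M n \<omega>)\<^sup>2) \<omega> = (M m \<omega>)\<^sup>2 + 1"
    using normal by (simp add: normal_martingale_def Suc lessThan_Suc_atMost)
  moreover have "AE \<omega> in P. ?E (\<lambda>\<omega>. (M m \<omega>)\<^sup>2) \<omega> = (M m \<omega>)\<^sup>2"
    by (rule real_cond_exp_F_meas) (use Mm in \<open>auto intro: M_square_integrable\<close>)
  moreover have "AE \<omega> in P. ?E (\<lambda>\<omega>. M m \<omega> * Z n \<omega>) \<omega> = M m \<omega> * ?E (Z n) \<omega>"
    by (rule real_cond_exp_mult) (use Mm int in auto)
  moreover have "AE \<omega> in P. ?E (\<lambda>\<omega>. 2 * (M m \<omega> * Z n \<omega>)) \<omega> = 2 * ?E (\<lambda>\<omega>. M m \<omega> * Z n \<omega>) \<omega>"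
    by (rule real_cond_exp_cmult) (rule int)
  moreover have "AE \<omega> in P. ?E (\<lambda>\<omega>. (M n \<omega>)\<^sup>2 - (M m \<omega>)\<^sup>2) \<omega> = ?E (\<lambda>\<omega>. (M n \<omega>)\<^sup>2) \<omega> - ?E (\<lambda>\<omega>. (M m \<omega>)\<^sup>2) \<omega>"
    by (rule real_cond_exp_diff) (rule M_square_integrable)+
  moreover have "AE \<omega> in P. ?E (\<lambda>\<omega>. (Z n \<omega>)\<^sup>2) \<omega> =
      ?E (\<lambda>\<omega>. (M n \<omega>)\<^sup>2 - (M m \<omega>)\<^sup>2) \<omega> - ?E (\<lambda>\<omega>. 2 * (M m \<omega> * Z n \<omega>)) \<omega>"
    unfolding eq by (rule real_cond_exp_diff) (use int M_square_integrable in auto)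
  moreover note cond_exp_noise[of n]
  ultimately show ?thesis by eventually_elim simp
qed

text \<open>A factor known before time \<open>n\<close> allows \<open>Z n\<close> to be replaced by
  its conditional expectation under the integral.\<close>

lemma integral_mult_noise:
  assumes f: "f \<in> borel_measurable (past n)" and int: "integrable P (\<lambda>\<omega>. f \<omega> * Z n \<omega>)"
  shows "(\<integral>\<omega>. f \<omega> * Z n \<omega> \<partial>P) = 0"
proof -
  interpret sigma_finite_subalgebra P "past n" by (rule sigma_finite_subalgebra_sigma_of)
  have "(\<integral>\<omega>. f \<omega> * Z n \<omega> \<partial>P) = (\<integral>\<omega>. f \<omega> * real_cond_exp P (past n) (Z n) \<omega> \<partial>P)"
    using real_cond_exp_intg(2)[OF int f] by simp
  also have "\<dots> = (\<integral>\<omega>. 0 \<partial>P)"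
  proof (rule integral_cong_AE)
    show "AE \<omega> in P. f \<omega> * real_cond_exp P (past n) (Z n) \<omega> = 0"
      using cond_exp_noise[of n] by eventually_elim simp
  qed (use measurable_from_subalg[OF subalg f] in auto)
  finally show ?thesis by simp
qed

text \<open>The nonnegative version can be used under integrals before any integrability is known.
  It follows from the real version because the negative part of a square is 0.\<close>

lemma nn_cond_exp_noise_square:
  "AE \<omega> in P. nn_cond_exp P (past n) (\<lambda>\<omega>. ennreal ((Z n \<omega>)\<^sup>2)) \<omega> = 1"
proof -
  interpret sigma_finite_subalgebra P "past n" by (rule sigma_finite_subalgebra_sigma_of)
  have "AE \<omega> in P. 0 = nn_cond_exp P (past n) (\<lambda>\<omega>. ennreal (- (Z n \<omega>)\<^sup>2)) \<omega>"
    using nn_cond_exp_F_meas[of "\<lambda>_. 0"] by (simp add: ennreal_neg)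
  with cond_exp_noise_square[of n] show ?thesis
    unfolding real_cond_exp_def
  proof eventually_elim
    case (elim \<omega>)
    then have "enn2real (nn_cond_exp P (past n) (\<lambda>\<omega>. ennreal ((Z n \<omega>)\<^sup>2)) \<omega>) = 1"
      by (metis diff_zero enn2real_0)
    \<comment> \<open>The value cannot be infinite, since \<open>enn2real\<close> sends infinity to
      0 rather than to 1.\<close>
    then show ?case by (metis ennreal_1 ennreal_enn2real enn2real_top top.not_eq_extremum zero_neq_one)
  qed
qed

text \<open>No fourth moments are assumed, so integrability of the product does not come from
  Cauchy-Schwarz. It comes from the nonnegative conditional expectation, which shows that the
  absolute integral equals that of \<open>f\<close>.\<close>

lemma integral_mult_noise_square:
  assumes f: "f \<in> borel_measurable (past n)" and int: "integrable P f"
  shows "integrable P (\<lambda>\<omega>. f \<omega> * (Z n \<omega>)\<^sup>2)"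
    and "(\<integral>\<omega>. f \<omega> * (Z n \<omega>)\<^sup>2 \<partial>P) = (\<integral>\<omega>. f \<omega> \<partial>P)"
proof -
  interpret sigma_finite_subalgebra P "past n" by (rule sigma_finite_subalgebra_sigma_of)
  have [measurable]: "f \<in> borel_measurable P" by (rule measurable_from_subalg[OF subalg f])
  have "(\<integral>\<^sup>+\<omega>. ennreal (norm (f \<omega> * (Z n \<omega>)\<^sup>2)) \<partial>P) =
      (\<integral>\<^sup>+\<omega>. ennreal \<bar>f \<omega>\<bar> * ennreal ((Z n \<omega>)\<^sup>2) \<partial>P)"
    by (simp add: abs_mult ennreal_mult)
  also have "\<dots> = (\<integral>\<^sup>+\<omega>. ennreal \<bar>f \<omega>\<bar> * nn_cond_exp P (past n) (\<lambda>\<omega>. ennreal ((Z n \<omega>)\<^sup>2)) \<omega> \<partial>P)"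
    by (rule nn_cond_exp_intg[symmetric]) (use f in measurable)
  also have "\<dots> = (\<integral>\<^sup>+\<omega>. ennreal \<bar>f \<omega>\<bar> \<partial>P)"
    by (rule nn_integral_cong_AE) (use nn_cond_exp_noise_square[of n] in auto)
  also have "\<dots> < \<infinity>" using int by (simp add: integrable_iff_bounded)
  finally show 1: "integrable P (\<lambda>\<omega>. f \<omega> * (Z n \<omega>)\<^sup>2)" by (simp add: integrable_iff_bounded)
  have "(\<integral>\<omega>. f \<omega> * (Z n \<omega>)\<^sup>2 \<partial>P) = (\<integral>\<omega>. f \<omega> * real_cond_exp P (past n) (\<lambda>\<omega>. (Z n \<omega>)\<^sup>2) \<omega> \<partial>P)"
    using real_cond_exp_intg(2)[OF 1 f] by simp
  also have "\<dots> = (\<integral>\<omega>. f \<omega> \<partial>P)"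
    by (rule integral_cong_AE) (use cond_exp_noise_square[of n] in auto)
  finally show "(\<integral>\<omega>. f \<omega> * (Z n \<omega>)\<^sup>2 \<partial>P) = (\<integral>\<omega>. f \<omega> \<partial>P)" .
qed

section \<open>Products of the noise\<close>

lemma prod_noise_measurable_sigma_of:
  "(\<And>k. k \<in> \<sigma> \<Longrightarrow> {..k} \<subseteq> I) \<Longrightarrow> (\<lambda>\<omega>. \<Prod>k\<in>\<sigma>. Z k \<omega>) \<in> borel_measurable (sigma_of P M I)"
  by (rule borel_measurable_prod) (rule noise_measurable_sigma_of)

text \<open>Induction on the time horizon: when \<open>n\<close> occurs in the set, the square of
  the product over the earlier indices is integrable and known before time \<open>n\<close>, so it
  may be multiplied by the square of \<open>Z n\<close>.\<close>

lemma prod_noise_square_integrable: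
  "\<sigma> \<subseteq> {..<n} \<Longrightarrow> integrable P (\<lambda>\<omega>. (\<Prod>k\<in>\<sigma>. Z k \<omega>)\<^sup>2)"
proof (induction n arbitrary: \<sigma>)
  case (Suc n)
  show ?case
  proof (cases "n \<in> \<sigma>")
    case True
    have sub: "\<sigma> - {n} \<subseteq> {..<n}" using Suc.prems by auto
    have fin: "finite \<sigma>" using Suc.prems finite_subset by blast
    have "integrable P (\<lambda>\<omega>. (\<Prod>k\<in>\<sigma> - {n}. Z k \<omega>)\<^sup>2 * (Z n \<omega>)\<^sup>2)"
      by (intro integral_mult_noise_square(1) Suc.IH sub borel_measurable_power
          prod_noise_measurable_sigma_of) (use sub in auto)
    then show ?thesis
      by (simp add: prod.remove[OF fin True] power_mult_distrib mult.commute)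
  next
    case False
    then have "\<sigma> \<subseteq> {..<n}" using Suc.prems by (auto simp: less_Suc_eq)
    then show ?thesis by (rule Suc.IH)
  qed
qed simp

lemma prod_noise_integrable:
  assumes "finite \<sigma>" "finite \<tau>"
  shows "integrable P (\<lambda>\<omega>. (\<Prod>k\<in>\<sigma>. Z k \<omega>) * (\<Prod>k\<in>\<tau>. Z k \<omega>))"
proof -
  obtain n m where "\<sigma> \<subseteq> {..<n}" "\<tau> \<subseteq> {..<m}"
    using assms by (meson finite_nat_iff_bounded)
  then show ?thesis
    by (intro integrable_mult_of_squares prod_noise_square_integrable) auto
qed

text \<open>Induction on the time horizon by splitting off the latest factor \<open>Z n\<close>. If
  it occurs in both products, its square has conditional mean 1 and the induction hypothesis
  applies; if in exactly one, its conditional mean 0 kills the integral.\<close>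

lemma prod_noise_orthonormal:
  "\<sigma> \<subseteq> {..<n} \<Longrightarrow> \<tau> \<subseteq> {..<n} \<Longrightarrow>
    (\<integral>\<omega>. (\<Prod>k\<in>\<sigma>. Z k \<omega>) * (\<Prod>k\<in>\<tau>. Z k \<omega>) \<partial>P) = (if \<sigma> = \<tau> then 1 else 0)"
proof (induction n arbitrary: \<sigma> \<tau>)
  case 0
  then show ?case by (simp add: prob_space)
next
  case (Suc n)
  let ?z = "\<lambda>\<sigma> \<omega>. \<Prod>k\<in>\<sigma>. Z k \<omega>"
  have sub: "\<sigma> - {n} \<subseteq> {..<n}" "\<tau> - {n} \<subseteq> {..<n}" using Suc.prems by auto
  have fin: "finite \<sigma>" "finite \<tau>" using Suc.prems finite_subset by blast+
  \<comment> \<open>Removing \<open>n\<close> from both sets gives one integrand, known before time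
    \<open>n\<close>, that serves all three cases.\<close>
  let ?f = "\<lambda>\<omega>. ?z (\<sigma> - {n}) \<omega> * ?z (\<tau> - {n}) \<omega>"
  have f: "?f \<in> borel_measurable (past n)"
    by (intro borel_measurable_times prod_noise_measurable_sigma_of) (use sub in auto)
  have intf: "integrable P ?f" using fin by (intro prod_noise_integrable) auto
  have IH: "(\<integral>\<omega>. ?f \<omega> \<partial>P) = (if \<sigma> - {n} = \<tau> - {n} then 1 else 0)"
    by (rule Suc.IH[OF sub])
  have int: "integrable P (\<lambda>\<omega>. ?z \<sigma> \<omega> * ?z \<tau> \<omega>)" using fin by (rule prod_noise_integrable)
  have split: "?z \<rho> = (\<lambda>\<omega>. Z n \<omega> * ?z (\<rho> - {n}) \<omega>)" if "n \<in> \<rho>" "finite \<rho>" for \<rho>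
    by (rule ext) (rule prod.remove[OF that(2,1)])
  consider "n \<in> \<sigma>" "n \<in> \<tau>" | "n \<in> \<sigma> \<longleftrightarrow> n \<notin> \<tau>" | "n \<notin> \<sigma>" "n \<notin> \<tau>" by blast
  then show ?case
  proof cases
    case 1
    have "(\<lambda>\<omega>. ?z \<sigma> \<omega> * ?z \<tau> \<omega>) = (\<lambda>\<omega>. ?f \<omega> * (Z n \<omega>)\<^sup>2)"
      by (simp add: fun_cong[OF split[OF 1(1) fin(1)]] fun_cong[OF split[OF 1(2) fin(2)]]
          power2_eq_square mult_ac)
    moreover have "\<sigma> - {n} = \<tau> - {n} \<longleftrightarrow> \<sigma> = \<tau>" using 1 by blast
    ultimately show ?thesis using integral_mult_noise_square(2)[OF f intf] IH by simp
  next
    case 2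
    have "(\<lambda>\<omega>. ?z \<sigma> \<omega> * ?z \<tau> \<omega>) = (\<lambda>\<omega>. ?f \<omega> * Z n \<omega>)"
    proof (cases "n \<in> \<sigma>")
      case True
      then show ?thesis using 2 by (simp add: fun_cong[OF split[OF True fin(1)]] mult_ac)
    next
      case False
      then have "n \<in> \<tau>" using 2 by simp
      then show ?thesis using False by (simp add: fun_cong[OF split[OF \<open>n \<in> \<tau>\<close> fin(2)]] mult_ac)
    qed
    moreover have "\<sigma> \<noteq> \<tau>" using 2 by blast
    ultimately show ?thesis using integral_mult_noise[OF f] int by simp
  next
    case 3
    then show ?thesis using IH by simp
  qed
qed

lemma noise_prod_in_L2:
  assumes "\<sigma> \<in> Fin_Sets"
  shows "noise_prod M \<sigma> \<in> L2 P M"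
proof -
  obtain n where "\<sigma> \<subseteq> {..<n}"
    using assms by (auto simp: Fin_Sets_def finite_nat_iff_bounded)
  then have "integrable P (\<lambda>\<omega>. (\<Prod>k\<in>\<sigma>. Z k \<omega>)\<^sup>2)"
    by (rule prod_noise_square_integrable)
  then show ?thesis
    using prod_noise_measurable_sigma_of[of \<sigma> UNIV]
    by (auto simp: L2_def noise_prod_def simp flip: of_real_prod)
qed

lemma coef_noise_prod:
  assumes "\<sigma> \<in> Fin_Sets" "\<tau> \<in> Fin_Sets"
  shows "coef \<sigma> (noise_prod M \<tau>) = (if \<sigma> = \<tau> then 1 else 0)"
proof -
  have "finite (\<sigma> \<union> \<tau>)" using assms by (auto simp: Fin_Sets_def)
  then obtain n where "\<sigma> \<union> \<tau> \<subseteq> {..<n}" by (meson finite_nat_iff_bounded)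
  then have "(\<integral>\<omega>. (\<Prod>k\<in>\<sigma>. Z k \<omega>) * (\<Prod>k\<in>\<tau>. Z k \<omega>) \<partial>P) = (if \<sigma> = \<tau> then 1 else 0)"
    by (intro prod_noise_orthonormal) auto
  moreover have "coef \<sigma> (noise_prod M \<tau>) =
      complex_of_real (\<integral>\<omega>. (\<Prod>k\<in>\<sigma>. Z k \<omega>) * (\<Prod>k\<in>\<tau>. Z k \<omega>) \<partial>P)"
    unfolding l2_inner_def noise_prod_def integral_complex_of_real[symmetric] by simp
  ultimately show ?thesis by simp
qed

end

section \<open>The strong topology and martingales\<close>

lemma S_dual_linear:
  assumes "\<Phi> \<in> S_dual P M" "\<xi> \<in> S_space P M" "\<eta> \<in> S_space P M"
  shows "\<Phi> (\<lambda>\<omega>. a * \<xi> \<omega> + b * \<eta> \<omega>) = a * \<Phi> \<xi> + b * \<Phi> \<eta>"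
  using assms by (simp add: S_dual_def)

lemma strong_topology_triangle:
  fixes \<Phi> :: "'b \<Rightarrow> complex"
  shows "(SUP \<xi>\<in>B. ennreal (cmod (\<Phi> \<xi> - \<Theta> \<xi>)))
    \<le> (SUP \<xi>\<in>B. ennreal (cmod (\<Phi> \<xi> - \<Psi> \<xi>))) + (SUP \<xi>\<in>B. ennreal (cmod (\<Psi> \<xi> - \<Theta> \<xi>)))"
proof (rule SUP_least)
  fix \<xi> assume \<xi>: "\<xi> \<in> B"
  have "ennreal (cmod (\<Phi> \<xi> - \<Theta> \<xi>)) \<le> ennreal (cmod (\<Phi> \<xi> - \<Psi> \<xi>)) + ennreal (cmod (\<Psi> \<xi> - \<Theta> \<xi>))"
    using norm_triangle_ineq[of "\<Phi> \<xi> - \<Psi> \<xi>" "\<Psi> \<xi> - \<Theta> \<xi>"]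
    by (simp add: ennreal_leI flip: ennreal_plus)
  also have "\<dots> \<le> (SUP \<xi>\<in>B. ennreal (cmod (\<Phi> \<xi> - \<Psi> \<xi>))) + (SUP \<xi>\<in>B. ennreal (cmod (\<Psi> \<xi> - \<Theta> \<xi>)))"
    by (intro add_mono SUP_upper \<xi>)
  finally show "ennreal (cmod (\<Phi> \<xi> - \<Theta> \<xi>)) \<le> \<dots>" .
qed

text \<open>Reduces convergence to uniform estimates on one bounded set at a time. A ball around the
  limit is an open neighbourhood; conversely every neighbourhood contains a finite intersection of
  such balls.\<close>

lemma limitin_strong_topology_iff:
  "limitin (strong_topology P M) \<Phi> \<Psi> sequentially \<longleftrightarrow>
     \<Psi> \<in> S_dual P M \<and>
     (\<forall>B \<epsilon>. S_bounded P M B \<longrightarrow> 0 < \<epsilon> \<longrightarrow>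
        (\<forall>\<^sub>F n in sequentially. \<Phi> n \<in> S_dual P M \<and> (SUP \<xi>\<in>B. ennreal (cmod (\<Psi> \<xi> - \<Phi> n \<xi>))) < ennreal \<epsilon>))"
proof -
  \<comment> \<open>The empty set serves as an index for the description of
    \<open>topspace\<close>.\<close>
  have "S_bounded P M {}" by (simp add: S_bounded_def)
  then have top: "topspace (strong_topology P M) = S_dual P M"
    unfolding strong_topology_def
    by (intro topspace_family_topology[of "{}"]) (auto simp: SUP_eq_const bot_ennreal)
  show ?thesis
  proof (intro iffI conjI allI impI)
    assume lim: "limitin (strong_topology P M) \<Phi> \<Psi> sequentially"
    then show \<Psi>: "\<Psi> \<in> S_dual P M" using top limitin_topspace by metis
    fix B and \<epsilon> :: real assume B: "S_bounded P M B" and \<epsilon>: "0 < \<epsilon>"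
    let ?U = "{\<Theta> \<in> S_dual P M. (SUP \<xi>\<in>B. ennreal (cmod (\<Psi> \<xi> - \<Theta> \<xi>))) < ennreal \<epsilon>}"
    have "openin (strong_topology P M) ?U"
      unfolding strong_topology_def by (rule openin_family_topology_ball) (use \<Psi> B \<epsilon> in auto)
    moreover have "(SUP \<xi>\<in>B. ennreal (cmod (\<Psi> \<xi> - \<Psi> \<xi>))) < ennreal \<epsilon>"
      using \<epsilon> by (intro order.strict_trans1[OF SUP_least[of _ _ 0]]) auto
    ultimately show "\<forall>\<^sub>F n in sequentially. \<Phi> n \<in> S_dual P M \<and>
        (SUP \<xi>\<in>B. ennreal (cmod (\<Psi> \<xi> - \<Phi> n \<xi>))) < ennreal \<epsilon>"
      using lim \<Psi> unfolding limitin_def by (drule_tac conjunct2) (drule spec[of _ ?U], simp)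
  next
    assume R: "\<Psi> \<in> S_dual P M \<and> (\<forall>B \<epsilon>. S_bounded P M B \<longrightarrow> 0 < \<epsilon> \<longrightarrow>
      (\<forall>\<^sub>F n in sequentially. \<Phi> n \<in> S_dual P M \<and> (SUP \<xi>\<in>B. ennreal (cmod (\<Psi> \<xi> - \<Phi> n \<xi>))) < ennreal \<epsilon>))"
    \<comment> \<open>For the empty bounded set the estimate is trivial, and what remains is
      eventual membership in the dual.\<close>
    then have "\<forall>\<^sub>F n in sequentially. \<Phi> n \<in> S_dual P M \<and> (SUP \<xi>\<in>{}. ennreal (cmod (\<Psi> \<xi> - \<Phi> n \<xi>))) < ennreal 1"
      using \<open>S_bounded P M {}\<close> zero_less_one by blast
    then have ev: "\<forall>\<^sub>F n in sequentially. \<Phi> n \<in> S_dual P M"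
      by (rule eventually_mono) simp
    have "\<forall>\<^sub>F n in sequentially. \<Phi> n \<in> U" if U: "openin (strong_topology P M) U" "\<Psi> \<in> U" for U
    proof -
      let ?d = "\<lambda>B \<Phi> \<Psi>. SUP \<xi>\<in>B. ennreal (cmod (\<Phi> \<xi> - \<Psi> \<xi>))"
      have "\<exists>J \<delta>. finite J \<and> J \<subseteq> {B. S_bounded P M B} \<and> 0 < \<delta> \<and>
          (\<forall>\<Theta>\<in>S_dual P M. (\<forall>B\<in>J. ?d B \<Psi> \<Theta> < ennreal \<delta>) \<longrightarrow> \<Theta> \<in> U)"
        by (rule openin_family_topologyD[OF strong_topology_triangle])
          (use U R in \<open>auto simp: strong_topology_def\<close>)
      then obtain J \<delta> where J: "finite J" "J \<subseteq> {B. S_bounded P M B}" "0 < \<delta>"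
        and in_U: "\<And>\<Theta>. \<Theta> \<in> S_dual P M \<Longrightarrow> \<forall>B\<in>J. ?d B \<Psi> \<Theta> < ennreal \<delta> \<Longrightarrow> \<Theta> \<in> U"
        by blast
      have "\<forall>\<^sub>F n in sequentially. \<forall>B\<in>J. ?d B \<Psi> (\<Phi> n) < ennreal \<delta>"
      proof (rule eventually_ball_finite[OF J(1)], rule ballI)
        fix B assume "B \<in> J"
        then have "\<forall>\<^sub>F n in sequentially. \<Phi> n \<in> S_dual P M \<and> ?d B \<Psi> (\<Phi> n) < ennreal \<delta>"
          using R J by blast
        then show "\<forall>\<^sub>F n in sequentially. ?d B \<Psi> (\<Phi> n) < ennreal \<delta>"
          by (rule eventually_mono) simp
      qed
      with ev show ?thesis by eventually_elim (rule in_U)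
    qed
    then show "limitin (strong_topology P M) \<Phi> \<Psi> sequentially"
      using R top by (simp add: limitin_def)
  qed
qed

text \<open>Iterates the one-step relation: the indicator of the smaller power set absorbs that of
  the larger one.\<close>

lemma generalized_martingale_fock:
  assumes mart: "generalized_martingale P M \<Phi>" and "\<sigma> \<in> Fin_Sets" "n \<le> m"
  shows "fock_transform M (\<Phi> n) \<sigma> = indicator (Pow {0..n}) \<sigma> * fock_transform M (\<Phi> m) \<sigma>"
  using \<open>n \<le> m\<close>
proof (induction m rule: dec_induct)
  case base
  \<comment> \<open>The case \<open>m = n\<close> has content: the transform of
    \<open>\<Phi> n\<close> vanishes outside \<open>Pow {0..n}\<close>. This uses the relation to
    \<open>Suc n\<close> and the idempotence of the indicator.\<close>
  have "fock_transform M (\<Phi> n) \<sigma> = indicator (Pow {0..n}) \<sigma> * fock_transform M (\<Phi> (Suc n)) \<sigma>"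
    using assms unfolding generalized_martingale_def by blast
  then show ?case by (simp add: indicator_def)
next
  case (step m)
  have "fock_transform M (\<Phi> m) \<sigma> = indicator (Pow {0..m}) \<sigma> * fock_transform M (\<Phi> (Suc m)) \<sigma>"
    using assms unfolding generalized_martingale_def by blast
  moreover have "Pow {0..n} \<subseteq> Pow {0..m}" using step by auto
  ultimately show ?case using step.IH by (auto simp: indicator_def)
qed

section \<open>Generalized functionals\<close>

context normal_martingale_space
begin

section \<open>Linearity of the Fourier coefficients\<close>

lemma L2_cmult_add:
  assumes "\<xi> \<in> L2 P M" "\<eta> \<in> L2 P M"
  shows "(\<lambda>\<omega>. a * \<xi> \<omega> + b * \<eta> \<omega>) \<in> L2 P M"
proof -
  have m: "\<xi> \<in> borel_measurable (sigma_of P M UNIV)" "\<eta> \<in> borel_measurable (sigma_of P M UNIV)"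
    using assms by (auto simp: L2_def)
  note [measurable] = measurable_from_subalg[OF subalgebra_sigma_of m(1)]
    measurable_from_subalg[OF subalgebra_sigma_of m(2)]
  have "integrable P (\<lambda>\<omega>. (cmod (a * \<xi> \<omega> + b * \<eta> \<omega>))\<^sup>2)"
  proof (rule Bochner_Integration.integrable_bound)
    show "integrable P (\<lambda>\<omega>. 2 * (cmod a)\<^sup>2 * (cmod (\<xi> \<omega>))\<^sup>2 + 2 * (cmod b)\<^sup>2 * (cmod (\<eta> \<omega>))\<^sup>2)"
      using assms by (auto simp: L2_def)
    have "(cmod (x + y))\<^sup>2 \<le> 2 * (cmod x)\<^sup>2 + 2 * (cmod y)\<^sup>2" for x y
    proof -
      have "(cmod (x + y))\<^sup>2 \<le> (cmod x + cmod y)\<^sup>2"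
        by (intro power_mono norm_triangle_ineq) simp
      also have "\<dots> \<le> 2 * (cmod x)\<^sup>2 + 2 * (cmod y)\<^sup>2"
        using sum_squares_bound[of "cmod x" "cmod y"] by (simp add: power2_sum)
      finally show ?thesis .
    qed
    from this[of "a * \<xi> _" "b * \<eta> _"]
    show "AE \<omega> in P. norm ((cmod (a * \<xi> \<omega> + b * \<eta> \<omega>))\<^sup>2)
        \<le> norm (2 * (cmod a)\<^sup>2 * (cmod (\<xi> \<omega>))\<^sup>2 + 2 * (cmod b)\<^sup>2 * (cmod (\<eta> \<omega>))\<^sup>2)"
      by (simp add: norm_mult power_mult_distrib mult.assoc)
  qed measurable
  moreover have "(\<lambda>\<omega>. a * \<xi> \<omega> + b * \<eta> \<omega>) \<in> borel_measurable (sigma_of P M UNIV)"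
    using m by measurable
  ultimately show ?thesis by (simp add: L2_def)
qed

lemma integrable_l2_inner:
  assumes "\<xi> \<in> L2 P M" "\<eta> \<in> L2 P M"
  shows "integrable P (\<lambda>\<omega>. cnj (\<xi> \<omega>) * \<eta> \<omega>)"
proof -
  have m: "\<xi> \<in> borel_measurable (sigma_of P M UNIV)" "\<eta> \<in> borel_measurable (sigma_of P M UNIV)"
    using assms by (auto simp: L2_def)
  note [measurable] = measurable_from_subalg[OF subalgebra_sigma_of m(1)]
    measurable_from_subalg[OF subalgebra_sigma_of m(2)]
  have [measurable]: "(\<lambda>\<omega>. cnj (\<xi> \<omega>)) \<in> borel_measurable P"
    by (rule borel_measurable_continuous_on[where f = cnj]) (auto intro!: continuous_intros)
  have "integrable P (\<lambda>\<omega>. cmod (\<xi> \<omega>) * cmod (\<eta> \<omega>))"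
    by (rule integrable_mult_of_squares) (use assms in \<open>auto simp: L2_def\<close>)
  then show ?thesis
    by (rule Bochner_Integration.integrable_bound)
      (auto simp: norm_mult)
qed

lemma coef_cmult_add:
  assumes "\<sigma> \<in> Fin_Sets" "\<xi> \<in> L2 P M" "\<eta> \<in> L2 P M"
  shows "coef \<sigma> (\<lambda>\<omega>. a * \<xi> \<omega> + b * \<eta> \<omega>) = a * coef \<sigma> \<xi> + b * coef \<sigma> \<eta>"
proof -
  note int = integrable_l2_inner[OF noise_prod_in_L2[OF assms(1)]]
  have "coef \<sigma> (\<lambda>\<omega>. a * \<xi> \<omega> + b * \<eta> \<omega>) =
    (\<integral>\<omega>. a * (cnj (noise_prod M \<sigma> \<omega>) * \<xi> \<omega>) + b * (cnj (noise_prod M \<sigma> \<omega>) * \<eta> \<omega>) \<partial>P)"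
    unfolding l2_inner_def by (simp add: algebra_simps)
  also have "\<dots> = a * coef \<sigma> \<xi> + b * coef \<sigma> \<eta>"
    unfolding l2_inner_def
    using int[OF assms(2)] int[OF assms(3)] by simp
  finally show ?thesis .
qed

section \<open>The norms of the test functional space\<close>

abbreviation "wcoef p \<xi> \<sigma> \<equiv> weight \<sigma> powr p * cmod (coef \<sigma> \<xi>)"

lemma wcoef_square: "weight \<sigma> powr (2 * p) * (cmod (coef \<sigma> \<xi>))\<^sup>2 = (wcoef p \<xi> \<sigma>)\<^sup>2"
  by (simp add: power_mult_distrib power2_eq_square flip: powr_add)

text \<open>In this form the norm is the square-sum norm of the weighted coefficients, to which
  Minkowski and Cauchy-Schwarz apply.\<close>

lemma p_norm_eq: "p_norm P M p \<xi> = sqrt (\<Sum>\<^sub>\<infinity>\<sigma>\<in>Fin_Sets. (wcoef p \<xi> \<sigma>)\<^sup>2)"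
  unfolding p_norm_def wcoef_square ..

lemma p_norm_nonneg: "0 \<le> p_norm P M p \<xi>"
  by (simp add: p_norm_eq infsum_nonneg)

lemma wcoef_square_mono: "p \<le> q \<Longrightarrow> (wcoef p \<xi> \<sigma>)\<^sup>2 \<le> (wcoef q \<xi> \<sigma>)\<^sup>2"
  by (intro power_mono mult_right_mono powr_mono weight_ge_1) auto

text \<open>The definition intersects over natural orders only; since weights are at least 1, a
  natural order above \<open>p\<close> dominates every real order \<open>p\<close>.\<close>

lemma S_space_iff:
  "\<xi> \<in> S_space P M \<longleftrightarrow> \<xi> \<in> L2 P M \<and> (\<forall>p. (\<lambda>\<sigma>. (wcoef p \<xi> \<sigma>)\<^sup>2) summable_on Fin_Sets)"
proof -
  have "(\<lambda>\<sigma>. (wcoef p \<xi> \<sigma>)\<^sup>2) summable_on Fin_Sets"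
    if *: "\<And>n::nat. (\<lambda>\<sigma>. (wcoef (real n) \<xi> \<sigma>)\<^sup>2) summable_on Fin_Sets" for p
  proof -
    obtain n where "p \<le> real n" using real_arch_simple by blast
    then show ?thesis
      by (intro summable_on_comparison_test[OF *[of n]] wcoef_square_mono) auto
  qed
  then show ?thesis
    unfolding S_space_def Sp_def wcoef_square by auto
qed

lemma S_space_L2: "\<xi> \<in> S_space P M \<Longrightarrow> \<xi> \<in> L2 P M"
  and S_space_summable: "\<xi> \<in> S_space P M \<Longrightarrow> (\<lambda>\<sigma>. (wcoef p \<xi> \<sigma>)\<^sup>2) summable_on Fin_Sets"
  by (auto simp: S_space_iff)

lemma p_norm_mono: "\<xi> \<in> S_space P M \<Longrightarrow> p \<le> q \<Longrightarrow> p_norm P M p \<xi> \<le> p_norm P M q \<xi>"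
  unfolding p_norm_eq
  by (intro real_sqrt_le_mono infsum_mono S_space_summable wcoef_square_mono)

text \<open>Minkowski's inequality for the weighted coefficients gives both closure under linear
  combinations and the seminorm estimate.\<close>

lemma S_space_cmult_add:
  assumes "\<xi> \<in> S_space P M" "\<eta> \<in> S_space P M"
  shows "(\<lambda>\<omega>. a * \<xi> \<omega> + b * \<eta> \<omega>) \<in> S_space P M" (is "?\<zeta> \<in> _")
    and "p_norm P M p (\<lambda>\<omega>. a * \<xi> \<omega> + b * \<eta> \<omega>) \<le> cmod a * p_norm P M p \<xi> + cmod b * p_norm P M p \<eta>"
proof -
  have summ: "(\<lambda>\<sigma>. (cmod c * wcoef p \<zeta> \<sigma>)\<^sup>2) summable_on Fin_Sets"
    and sqrt: "sqrt (\<Sum>\<^sub>\<infinity>\<sigma>\<in>Fin_Sets. (cmod c * wcoef p \<zeta> \<sigma>)\<^sup>2) = cmod c * p_norm P M p \<zeta>"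
    if "\<zeta> \<in> S_space P M" for c \<zeta> p
    using S_space_summable[OF that, of p]
    by (auto simp: p_norm_eq power_mult_distrib[of "cmod c"] infsum_cmult_right real_sqrt_mult
        intro: summable_on_cmult_right)
  have le: "(wcoef p ?\<zeta> \<sigma>)\<^sup>2 \<le> (cmod a * wcoef p \<xi> \<sigma> + cmod b * wcoef p \<eta> \<sigma>)\<^sup>2"
    if "\<sigma> \<in> Fin_Sets" for \<sigma> p
  proof (rule power_mono)
    have "coef \<sigma> ?\<zeta> = a * coef \<sigma> \<xi> + b * coef \<sigma> \<eta>"
      using assms that by (intro coef_cmult_add S_space_L2)
    then have "cmod (coef \<sigma> ?\<zeta>) \<le> cmod a * cmod (coef \<sigma> \<xi>) + cmod b * cmod (coef \<sigma> \<eta>)"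
      by (metis norm_mult norm_triangle_ineq)
    then have "wcoef p ?\<zeta> \<sigma> \<le> weight \<sigma> powr p * (cmod a * cmod (coef \<sigma> \<xi>) + cmod b * cmod (coef \<sigma> \<eta>))"
      by (rule mult_left_mono) simp
    then show "wcoef p ?\<zeta> \<sigma> \<le> cmod a * wcoef p \<xi> \<sigma> + cmod b * wcoef p \<eta> \<sigma>"
      by (simp add: algebra_simps)
  qed simp
  note add = square_summable_add[OF summ[OF assms(1), of a] summ[OF assms(2), of b]]
  have summ': "(\<lambda>\<sigma>. (wcoef p ?\<zeta> \<sigma>)\<^sup>2) summable_on Fin_Sets" for p
    by (rule summable_on_comparison_test[OF add(1) le]) auto
  with assms show "?\<zeta> \<in> S_space P M"
    by (simp add: S_space_iff L2_cmult_add)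
  have "p_norm P M p ?\<zeta> \<le> sqrt (\<Sum>\<^sub>\<infinity>\<sigma>\<in>Fin_Sets. (cmod a * wcoef p \<xi> \<sigma> + cmod b * wcoef p \<eta> \<sigma>)\<^sup>2)"
    unfolding p_norm_eq by (intro real_sqrt_le_mono infsum_mono summ' add(1) le)
  also have "\<dots> \<le> cmod a * p_norm P M p \<xi> + cmod b * p_norm P M p \<eta>"
    using add(2)[of p] by (simp add: sqrt assms)
  finally show "p_norm P M p ?\<zeta> \<le> cmod a * p_norm P M p \<xi> + cmod b * p_norm P M p \<eta>" .
qed

lemma S_space_diff:
  assumes "\<xi> \<in> S_space P M" "\<eta> \<in> S_space P M"
  shows "(\<lambda>\<omega>. \<xi> \<omega> - \<eta> \<omega>) \<in> S_space P M"
  using S_space_cmult_add(1)[OF assms, of 1 "-1"] by simp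

lemma coef_diff:
  assumes "\<sigma> \<in> Fin_Sets" "\<xi> \<in> L2 P M" "\<eta> \<in> L2 P M"
  shows "coef \<sigma> (\<lambda>\<omega>. \<xi> \<omega> - \<eta> \<omega>) = coef \<sigma> \<xi> - coef \<sigma> \<eta>"
  using coef_cmult_add[OF assms, of 1 "-1"] by simp

lemma S_dual_diff:
  assumes "\<Phi> \<in> S_dual P M" "\<xi> \<in> S_space P M" "\<eta> \<in> S_space P M"
  shows "\<Phi> (\<lambda>\<omega>. \<xi> \<omega> - \<eta> \<omega>) = \<Phi> \<xi> - \<Phi> \<eta>"
  using S_dual_linear[OF assms, of 1 "-1"] by simp

lemma p_norm_diff_triangle:
  assumes "\<xi> \<in> S_space P M" "\<eta> \<in> S_space P M" "\<zeta> \<in> S_space P M"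
  shows "p_norm P M p (\<lambda>\<omega>. \<xi> \<omega> - \<zeta> \<omega>)
    \<le> p_norm P M p (\<lambda>\<omega>. \<xi> \<omega> - \<eta> \<omega>) + p_norm P M p (\<lambda>\<omega>. \<eta> \<omega> - \<zeta> \<omega>)"
  using S_space_cmult_add(2)[OF S_space_diff[OF assms(1,2)] S_space_diff[OF assms(2,3)], of p 1 1]
  by simp

lemma noise_prod_wcoef:
  assumes "\<sigma> \<in> Fin_Sets" "\<tau> \<in> Fin_Sets"
  shows "(wcoef p (noise_prod M \<tau>) \<sigma>)\<^sup>2 = (if \<sigma> = \<tau> then (weight \<tau> powr p)\<^sup>2 else 0)"
  using coef_noise_prod[OF assms] by simp

lemma noise_prod_in_S_space:
  assumes "\<tau> \<in> Fin_Sets"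
  shows "noise_prod M \<tau> \<in> S_space P M"
proof -
  have "(\<lambda>\<sigma>. (wcoef p (noise_prod M \<tau>) \<sigma>)\<^sup>2) summable_on Fin_Sets" for p
    by (rule summable_on_cong_neutral[THEN iffD1, OF _ _ _ summable_on_finite[of "{\<tau>}"]])
      (use assms noise_prod_wcoef[OF _ assms] in auto)
  then show ?thesis by (simp add: S_space_iff noise_prod_in_L2 assms)
qed

text \<open>Orthonormality leaves one term of the sum. Through this value a norm bound on a
  functional becomes a weight bound on its Fock transform.\<close>

lemma p_norm_noise_prod:
  assumes "\<tau> \<in> Fin_Sets"
  shows "p_norm P M p (noise_prod M \<tau>) = weight \<tau> powr p"
proof -
  have "(\<Sum>\<^sub>\<infinity>\<sigma>\<in>Fin_Sets. (wcoef p (noise_prod M \<tau>) \<sigma>)\<^sup>2) = (\<Sum>\<^sub>\<infinity>\<sigma>\<in>{\<tau>}. (weight \<tau> powr p)\<^sup>2)"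
    by (rule infsum_cong_neutral) (use assms noise_prod_wcoef[OF _ assms] in auto)
  then show ?thesis by (simp add: p_norm_eq)
qed

lemma zero_in_S_space: "(\<lambda>_. 0) \<in> S_space P M"
  using S_space_cmult_add(1)[of "noise_prod M {}" "noise_prod M {}" 0 0] noise_prod_in_S_space[of "{}"]
  by (simp add: Fin_Sets_def)

lemma p_norm_zero: "p_norm P M p (\<lambda>_. 0) = 0"
  by (simp add: p_norm_eq l2_inner_def)

text \<open>The distance from 0 to \<open>\<xi>\<close> is by definition the norm of
  \<open>0 - \<xi>\<close>; this estimate controls it by the norm of \<open>\<xi>\<close>.\<close>

lemma p_norm_minus:
  assumes "\<xi> \<in> S_space P M"
  shows "p_norm P M p (\<lambda>\<omega>. - \<xi> \<omega>) \<le> p_norm P M p \<xi>"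
  using S_space_cmult_add(2)[OF assms assms, of p "-1" 0] by simp

section \<open>Continuous functionals and their expansion\<close>

lemma topspace_S_topology: "topspace (S_topology P M) = S_space P M"
  unfolding S_topology_def by (rule topspace_family_topology[of 0]) (auto simp: p_norm_zero)

text \<open>Continuity at 0 involves finitely many norms. They increase with the order, so the
  largest order controls them all, and homogeneity turns a bound on a ball into a bound
  everywhere.\<close>

lemma S_dual_bound:
  assumes "\<Phi> \<in> S_dual P M"
  shows "\<exists>K p. 0 \<le> K \<and> 0 \<le> p \<and> (\<forall>\<xi>\<in>S_space P M. cmod (\<Phi> \<xi>) \<le> K * p_norm P M p \<xi>)"
proof -
  define U where "U = {\<xi> \<in> topspace (S_topology P M). \<Phi> \<xi> \<in> ball 0 1}"
  let ?d = "\<lambda>p \<xi> \<eta>. ennreal (p_norm P M p (\<lambda>\<omega>. \<xi> \<omega> - \<eta> \<omega>))"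
  have scale: "\<Phi> (\<lambda>\<omega>. a * \<xi> \<omega>) = a * \<Phi> \<xi>" if "\<xi> \<in> S_space P M" for a \<xi>
    using S_dual_linear[OF assms that that, of a 0] by simp
  have "\<Phi> (\<lambda>_. 0) = 0" using scale[OF zero_in_S_space, of 0] by simp
  then have 0: "(\<lambda>_. 0) \<in> U" by (simp add: U_def topspace_S_topology zero_in_S_space)
  have U: "openin (S_topology P M) U"
    unfolding U_def using assms by (intro openin_continuous_map_preimage[of _ euclidean]) (auto simp: S_dual_def)
  have "\<exists>J \<delta>. finite J \<and> J \<subseteq> {p. 0 \<le> p} \<and> 0 < \<delta> \<and>
      (\<forall>\<xi>\<in>S_space P M. (\<forall>p\<in>J. ?d p (\<lambda>_. 0) \<xi> < ennreal \<delta>) \<longrightarrow> \<xi> \<in> U)"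
  proof (rule openin_family_topologyD[OF _ U[unfolded S_topology_def] 0 zero_in_S_space])
    fix p \<xi> \<eta> \<zeta> assume "\<xi> \<in> S_space P M" "\<eta> \<in> S_space P M" "\<zeta> \<in> S_space P M"
    then show "?d p \<xi> \<zeta> \<le> ?d p \<xi> \<eta> + ?d p \<eta> \<zeta>"
      using p_norm_diff_triangle[of \<xi> \<eta> \<zeta> p]
      by (simp add: p_norm_nonneg ennreal_leI flip: ennreal_plus)
  qed
  then obtain J \<delta> where J: "finite J" "J \<subseteq> {p. 0 \<le> p}" "0 < \<delta>"
    and in_U: "\<And>\<xi>. \<xi> \<in> S_space P M \<Longrightarrow> \<forall>p\<in>J. ?d p (\<lambda>_. 0) \<xi> < ennreal \<delta> \<Longrightarrow> \<xi> \<in> U"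
    by blast
  \<comment> \<open>Inserting 0 makes the maximum meaningful for empty \<open>J\<close> and ensures
    \<open>0 \<le> q\<close>.\<close>
  define q where "q = Max (insert 0 J)"
  have q: "0 \<le> q" "\<And>p. p \<in> J \<Longrightarrow> p \<le> q" using J(1) by (auto simp: q_def)
  have small: "cmod (\<Phi> \<xi>) < 1" if \<xi>: "\<xi> \<in> S_space P M" "p_norm P M q \<xi> < \<delta>" for \<xi>
  proof -
    have "p_norm P M p (\<lambda>\<omega>. - \<xi> \<omega>) < \<delta>" if "p \<in> J" for p
      using p_norm_minus[OF \<xi>(1), of p] p_norm_mono[OF \<xi>(1) q(2)[OF that]] \<xi>(2) by linarith
    then have "\<xi> \<in> U"
      by (intro in_U \<xi>) (simp add: ennreal_less_iff p_norm_nonneg)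
    then show ?thesis by (simp add: U_def)
  qed
  have scaled: "t * cmod (\<Phi> \<xi>) < 1" if \<xi>: "\<xi> \<in> S_space P M" "0 < t" "t * p_norm P M q \<xi> < \<delta>" for \<xi> t
  proof -
    let ?\<eta> = "\<lambda>\<omega>. complex_of_real t * \<xi> \<omega>"
    have "?\<eta> \<in> S_space P M" "p_norm P M q ?\<eta> \<le> t * p_norm P M q \<xi>"
      using S_space_cmult_add(1)[OF \<xi>(1) \<xi>(1), of "complex_of_real t" 0]
        S_space_cmult_add(2)[OF \<xi>(1) \<xi>(1), of q "complex_of_real t" 0] \<xi>(2) by auto
    then have "cmod (\<Phi> ?\<eta>) < 1" using \<xi>(3) by (intro small) auto
    then show ?thesis using \<xi>(2) by (simp add: scale[OF \<xi>(1)] norm_mult)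
  qed
  have "cmod (\<Phi> \<xi>) \<le> 2 / \<delta> * p_norm P M q \<xi>" if \<xi>: "\<xi> \<in> S_space P M" for \<xi>
  proof (cases "p_norm P M q \<xi> = 0")
    case True
    \<comment> \<open>All multiples of \<open>\<xi>\<close> lie in the ball, so a nonzero value
      could be scaled to modulus 1, contradicting the strict bound.\<close>
    have "\<Phi> \<xi> = 0"
    proof (rule ccontr)
      assume "\<Phi> \<xi> \<noteq> 0"
      then show False using scaled[OF \<xi>, of "inverse (cmod (\<Phi> \<xi>))"] True J(3) by simp
    qed
    then show ?thesis using True by simp
  next
    case False
    then have N: "0 < p_norm P M q \<xi>" using p_norm_nonneg[of q \<xi>] by linarith
    \<comment> \<open>The factor brings the norm down to half of \<open>\<delta>\<close>, strictly
      inside the ball; hence the constant \<open>2 / \<delta>\<close>.\<close>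
    have "\<delta> / (2 * p_norm P M q \<xi>) * cmod (\<Phi> \<xi>) < 1"
      by (rule scaled[OF \<xi>]) (use N J(3) in auto)
    then show ?thesis using N J(3) by (simp add: field_simps)
  qed
  then show ?thesis using q(1) J(3) by (intro exI[of _ "2 / \<delta>"] exI[of _ q]) auto
qed

text \<open>Subtracting the Fourier sum over a finite \<open>A\<close> leaves exactly the
  coefficients outside \<open>A\<close>. The norm of the remainder is therefore the tail of a
  convergent sum, and \<open>S_dual_bound\<close> transfers its decay to the values of
  \<open>\<Phi>\<close>.\<close>

lemma S_dual_expansion:
  assumes \<Phi>: "\<Phi> \<in> S_dual P M" and \<xi>: "\<xi> \<in> S_space P M"
  shows "((\<lambda>\<sigma>. coef \<sigma> \<xi> * fock_transform M \<Phi> \<sigma>) has_sum \<Phi> \<xi>) Fin_Sets"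
proof -
  obtain K p where K: "0 \<le> K" "\<And>\<xi>. \<xi> \<in> S_space P M \<Longrightarrow> cmod (\<Phi> \<xi>) \<le> K * p_norm P M p \<xi>"
    using S_dual_bound[OF \<Phi>] by blast
  let ?s = "\<lambda>A \<omega>. \<Sum>\<sigma>\<in>A. coef \<sigma> \<xi> * noise_prod M \<sigma> \<omega>"
  \<comment> \<open>One induction carries all three facts, because linearity of
    \<open>\<Phi>\<close> and of the coefficients both need the partial sum to be a test
    functional.\<close>
  have partial: "?s A \<in> S_space P M \<and> \<Phi> (?s A) = (\<Sum>\<sigma>\<in>A. coef \<sigma> \<xi> * fock_transform M \<Phi> \<sigma>) \<and>
      (\<forall>\<tau>\<in>Fin_Sets. coef \<tau> (?s A) = (if \<tau> \<in> A then coef \<tau> \<xi> else 0))"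
    if "finite A" "A \<subseteq> Fin_Sets" for A
    using that
  proof (induction A rule: finite_induct)
    case empty
    have "\<Phi> (\<lambda>_. 0) = 0"
      using S_dual_linear[OF \<Phi> zero_in_S_space zero_in_S_space, of 0 0] by simp
    then show ?case by (simp add: zero_in_S_space l2_inner_def)
  next
    case (insert \<rho> A)
    have eq: "?s (insert \<rho> A) = (\<lambda>\<omega>. coef \<rho> \<xi> * noise_prod M \<rho> \<omega> + 1 * ?s A \<omega>)"
      using insert by simp
    have \<rho>: "\<rho> \<in> Fin_Sets" "noise_prod M \<rho> \<in> S_space P M"
      using insert.prems noise_prod_in_S_space by auto
    have IH: "?s A \<in> S_space P M" "\<Phi> (?s A) = (\<Sum>\<sigma>\<in>A. coef \<sigma> \<xi> * fock_transform M \<Phi> \<sigma>)"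
      "\<And>\<tau>. \<tau> \<in> Fin_Sets \<Longrightarrow> coef \<tau> (?s A) = (if \<tau> \<in> A then coef \<tau> \<xi> else 0)"
      using insert by auto
    have "coef \<tau> (?s (insert \<rho> A)) = (if \<tau> \<in> insert \<rho> A then coef \<tau> \<xi> else 0)" if "\<tau> \<in> Fin_Sets" for \<tau>
      unfolding eq using coef_cmult_add[OF that S_space_L2[OF \<rho>(2)] S_space_L2[OF IH(1)], of "coef \<rho> \<xi>" 1]
      using insert.hyps that \<rho>(1) by (simp add: IH(3) coef_noise_prod)
    moreover have "?s (insert \<rho> A) \<in> S_space P M"
      unfolding eq by (rule S_space_cmult_add(1)[OF \<rho>(2) IH(1)])
    moreover have "\<Phi> (?s (insert \<rho> A)) = (\<Sum>\<sigma>\<in>insert \<rho> A. coef \<sigma> \<xi> * fock_transform M \<Phi> \<sigma>)"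
      unfolding eq S_dual_linear[OF \<Phi> \<rho>(2) IH(1)] IH(2) using insert.hyps
      by (simp add: fock_transform_def)
    ultimately show ?case by blast
  qed
  have bound: "dist (\<Sum>\<sigma>\<in>A. coef \<sigma> \<xi> * fock_transform M \<Phi> \<sigma>) (\<Phi> \<xi>)
      \<le> K * sqrt (\<Sum>\<^sub>\<infinity>\<sigma>\<in>Fin_Sets - A. (wcoef p \<xi> \<sigma>)\<^sup>2)" if A: "finite A" "A \<subseteq> Fin_Sets" for A
  proof -
    let ?r = "\<lambda>\<omega>. \<xi> \<omega> - ?s A \<omega>"
    have s: "?s A \<in> S_space P M" using partial[OF A] by blast
    have r: "?r \<in> S_space P M" using S_space_diff[OF \<xi> s] .
    have coef_r: "coef \<tau> ?r = (if \<tau> \<in> A then 0 else coef \<tau> \<xi>)" if "\<tau> \<in> Fin_Sets" for \<tau>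
      using coef_diff[OF that S_space_L2[OF \<xi>] S_space_L2[OF s]] partial[OF A] that by simp
    have "dist (\<Sum>\<sigma>\<in>A. coef \<sigma> \<xi> * fock_transform M \<Phi> \<sigma>) (\<Phi> \<xi>) = cmod (\<Phi> ?r)"
      using S_dual_diff[OF \<Phi> \<xi> s] partial[OF A] by (simp add: dist_norm norm_minus_commute)
    also have "\<dots> \<le> K * p_norm P M p ?r" by (rule K(2)[OF r])
    also have "p_norm P M p ?r = sqrt (\<Sum>\<^sub>\<infinity>\<sigma>\<in>Fin_Sets - A. (wcoef p \<xi> \<sigma>)\<^sup>2)"
      unfolding p_norm_eq
      by (intro arg_cong[where f = sqrt] infsum_cong_neutral) (auto simp: coef_r)
    finally show ?thesis .
  qed
  have lim: "((\<lambda>A. K * sqrt (\<Sum>\<^sub>\<infinity>\<sigma>\<in>Fin_Sets - A. (wcoef p \<xi> \<sigma>)\<^sup>2)) \<longlongrightarrow> 0) (finite_subsets_at_top Fin_Sets)"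
    using tendsto_mult[OF tendsto_const[of K] tendsto_real_sqrt[OF infsum_Diff_tendsto_0[OF S_space_summable[OF \<xi>, of p]]]]
    by simp
  show ?thesis
    unfolding has_sum_def tendsto_dist_iff[of _ "\<Phi> \<xi>"]
    by (rule tendsto_sandwich[OF _ _ tendsto_const lim])
      (auto intro!: eventually_finite_subsets_at_top_weakI bound)
qed

text \<open>The factor \<open>inverse (weight \<sigma>)\<close> is square summable, so one extra power of the weight pays for
  the passage from the sum to the square sum.\<close>

lemma coef_sum_bound:
  assumes \<xi>: "\<xi> \<in> S_space P M" and A: "A \<subseteq> Fin_Sets"
    and F: "\<And>\<sigma>. \<sigma> \<in> A \<Longrightarrow> cmod (F \<sigma>) \<le> C * weight \<sigma> powr p"
  shows "(\<lambda>\<sigma>. coef \<sigma> \<xi> * F \<sigma>) summable_on A"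
    and "cmod (\<Sum>\<^sub>\<infinity>\<sigma>\<in>A. coef \<sigma> \<xi> * F \<sigma>)
      \<le> C * p_norm P M (p + 1) \<xi> * sqrt (\<Sum>\<^sub>\<infinity>\<sigma>\<in>A. (inverse (weight \<sigma>))\<^sup>2)"
proof -
  let ?T = "\<Sum>\<^sub>\<infinity>\<sigma>\<in>A. (inverse (weight \<sigma>))\<^sup>2"
  let ?g = "\<lambda>\<sigma>. \<bar>wcoef (p + 1) \<xi> \<sigma>\<bar> * \<bar>inverse (weight \<sigma>)\<bar>"
  have s1: "(\<lambda>\<sigma>. (wcoef (p + 1) \<xi> \<sigma>)\<^sup>2) summable_on A"
    by (rule summable_on_subset_banach[OF S_space_summable[OF \<xi>] A])
  have s2: "(\<lambda>\<sigma>. (inverse (weight \<sigma>))\<^sup>2) summable_on A"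
    by (rule summable_on_subset_banach[OF weight_square_inverse_summable A])
  note g = square_summable_mult[OF s1 s2]
  have le: "norm (coef \<sigma> \<xi> * F \<sigma>) \<le> C * ?g \<sigma>" if "\<sigma> \<in> A" for \<sigma>
  proof -
    have "norm (coef \<sigma> \<xi> * F \<sigma>) \<le> cmod (coef \<sigma> \<xi>) * (C * weight \<sigma> powr p)"
      unfolding norm_mult by (rule mult_left_mono[OF F[OF that]]) simp
    also have "\<dots> = C * ?g \<sigma>"
      using weight_pos[of \<sigma>] by (simp add: powr_add field_simps)
    finally show ?thesis .
  qed
  have abs: "(\<lambda>\<sigma>. norm (coef \<sigma> \<xi> * F \<sigma>)) summable_on A"
    by (rule Infinite_Sum.abs_summable_on_comparison_test'[OF summable_on_cmult_right[OF g(1)] le])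
  then show "(\<lambda>\<sigma>. coef \<sigma> \<xi> * F \<sigma>) summable_on A" by (rule abs_summable_summable)
  show "cmod (\<Sum>\<^sub>\<infinity>\<sigma>\<in>A. coef \<sigma> \<xi> * F \<sigma>) \<le> C * p_norm P M (p + 1) \<xi> * sqrt ?T"
  \<comment> \<open>For nonempty \<open>A\<close> the bound on \<open>F\<close> at any point forces
    \<open>0 \<le> C\<close>; for empty \<open>A\<close> both sides are 0.\<close>
  proof (cases "A = {}")
    case False
    then obtain \<sigma> where "\<sigma> \<in> A" by blast
    then have "0 \<le> C * weight \<sigma> powr p" using F[of \<sigma>] norm_ge_zero order_trans by blast
    then have C: "0 \<le> C" using weight_pos[of \<sigma>] by (simp add: zero_le_mult_iff)
    have "cmod (\<Sum>\<^sub>\<infinity>\<sigma>\<in>A. coef \<sigma> \<xi> * F \<sigma>) \<le> (\<Sum>\<^sub>\<infinity>\<sigma>\<in>A. norm (coef \<sigma> \<xi> * F \<sigma>))"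
      by (rule norm_infsum_bound[OF abs])
    also have "\<dots> \<le> (\<Sum>\<^sub>\<infinity>\<sigma>\<in>A. C * ?g \<sigma>)"
      by (rule infsum_mono[OF abs summable_on_cmult_right[OF g(1)] le])
    also have "\<dots> = C * (\<Sum>\<^sub>\<infinity>\<sigma>\<in>A. ?g \<sigma>)"
      by (rule infsum_cmult_right) (rule g(1))
    also have "\<dots> \<le> C * (sqrt (\<Sum>\<^sub>\<infinity>\<sigma>\<in>A. (wcoef (p + 1) \<xi> \<sigma>)\<^sup>2) * sqrt ?T)"
      by (rule mult_left_mono[OF g(2) C])
    also have "\<dots> \<le> C * (p_norm P M (p + 1) \<xi> * sqrt ?T)"
      unfolding p_norm_eq
      by (intro mult_left_mono mult_right_mono real_sqrt_le_mono infsum_mono2 s1 S_space_summable \<xi> A C)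
        (auto simp: infsum_nonneg)
    finally show ?thesis by (simp add: mult.assoc)
  qed simp
qed

text \<open>Converse of \<open>S_dual_bound\<close>: around each point of the preimage of an open
  set there is a ball for the single norm of order \<open>p\<close> that stays inside it.\<close>

lemma S_dual_of_bounded_linear:
  assumes lin: "\<And>\<xi> \<eta> a b. \<xi> \<in> S_space P M \<Longrightarrow> \<eta> \<in> S_space P M \<Longrightarrow>
      f (\<lambda>\<omega>. a * \<xi> \<omega> + b * \<eta> \<omega>) = a * f \<xi> + b * f \<eta>"
    and p: "0 \<le> p"
    and bound: "\<And>\<xi>. \<xi> \<in> S_space P M \<Longrightarrow> cmod (f \<xi>) \<le> K * p_norm P M p \<xi>"
  shows "restrict f (S_space P M) \<in> S_dual P M"
proof -
  let ?T = "S_topology P M" and ?f = "restrict f (S_space P M)"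
  have "openin ?T {\<xi> \<in> topspace ?T. ?f \<xi> \<in> U}" if "open U" for U
  proof (subst openin_subopen, intro ballI)
    fix \<xi> assume "\<xi> \<in> {\<xi> \<in> topspace ?T. ?f \<xi> \<in> U}"
    then have \<xi>: "\<xi> \<in> S_space P M" "f \<xi> \<in> U" by (auto simp: topspace_S_topology)
    then obtain e where e: "0 < e" "ball (f \<xi>) e \<subseteq> U" using \<open>open U\<close> openE by blast
    \<comment> \<open>The denominator \<open>\<bar>K\<bar> + 1\<close> is positive whatever the sign
      of \<open>K\<close>.\<close>
    define \<delta> where "\<delta> = e / (\<bar>K\<bar> + 1)"
    have \<delta>: "0 < \<delta>" using e by (simp add: \<delta>_def add_nonneg_pos)
    let ?V = "{\<eta> \<in> S_space P M. ennreal (p_norm P M p (\<lambda>\<omega>. \<xi> \<omega> - \<eta> \<omega>)) < ennreal \<delta>}"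
    have "f \<eta> \<in> U" if \<eta>: "\<eta> \<in> ?V" for \<eta>
    proof -
      have small: "p_norm P M p (\<lambda>\<omega>. \<xi> \<omega> - \<eta> \<omega>) < \<delta>"
        using \<eta> by (simp add: ennreal_less_iff p_norm_nonneg)
      have "f \<xi> - f \<eta> = f (\<lambda>\<omega>. \<xi> \<omega> - \<eta> \<omega>)"
        using lin[of \<xi> \<eta> 1 "-1"] \<xi> \<eta> by simp
      then have "dist (f \<xi>) (f \<eta>) \<le> K * p_norm P M p (\<lambda>\<omega>. \<xi> \<omega> - \<eta> \<omega>)"
        using bound[OF S_space_diff, of \<xi> \<eta>] \<xi> \<eta> by (simp add: dist_norm)
      also have "\<dots> \<le> (\<bar>K\<bar> + 1) * p_norm P M p (\<lambda>\<omega>. \<xi> \<omega> - \<eta> \<omega>)"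
        by (rule mult_right_mono) (simp_all add: p_norm_nonneg)
      also have "\<dots> < (\<bar>K\<bar> + 1) * \<delta>"
        by (rule mult_strict_left_mono[OF small]) (simp add: add_nonneg_pos)
      also have "\<dots> = e" by (simp add: \<delta>_def add_nonneg_pos less_imp_neq[symmetric])
      finally show ?thesis using e by auto
    qed
    moreover have "openin ?T ?V"
      unfolding S_topology_def by (rule openin_family_topology_ball) (use p \<xi> \<delta> in auto)
    moreover have "\<xi> \<in> ?V" using \<xi> \<delta> by (simp add: p_norm_zero)
    ultimately show "\<exists>V. openin ?T V \<and> \<xi> \<in> V \<and> V \<subseteq> {\<xi> \<in> topspace ?T. ?f \<xi> \<in> U}"
      by (intro exI[of _ ?V]) (auto simp: topspace_S_topology)
  qed
  then have "continuous_map ?T euclidean ?f" by (simp add: continuous_map_def)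
  then show ?thesis
    using lin by (simp add: S_dual_def S_space_cmult_add(1))
qed

section \<open>The two implications of the equivalence\<close>

lemma Pow_filterlim_finite_subsets: "filterlim (\<lambda>n. Pow {0..n}) (finite_subsets_at_top Fin_Sets) sequentially"
proof (subst filterlim_finite_subsets_at_top, intro allI impI)
  fix X :: "nat set set" assume X: "finite X \<and> X \<subseteq> Fin_Sets"
  then have "finite (\<Union>X)" by (auto simp: Fin_Sets_def)
  \<comment> \<open>Once \<open>n\<close> bounds all members of the sets in \<open>X\<close>, the
    power set of \<open>{0..n}\<close> contains \<open>X\<close>. Limits along finite families thus
    become limits along the truncations.\<close>
  then obtain N where N: "\<Union>X \<subseteq> {..N}" by (meson finite_nat_iff_bounded_le)
  have "finite (Pow {0..n}) \<and> X \<subseteq> Pow {0..n} \<and> Pow {0..n} \<subseteq> Fin_Sets" if "N \<le> n" for n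
  proof (intro conjI)
    have "\<Union>X \<subseteq> {0..n}" using N that by fastforce
    then show "X \<subseteq> Pow {0..n}" by blast
    show "Pow {0..n} \<subseteq> Fin_Sets" unfolding Fin_Sets_def using finite_subset[of _ "{0..n}"] by blast
  qed simp
  then show "\<forall>\<^sub>F n in sequentially. finite (Pow {0..n}) \<and> X \<subseteq> Pow {0..n} \<and> Pow {0..n} \<subseteq> Fin_Sets"
    by (rule eventually_sequentiallyI)
qed

text \<open>Strong convergence gives pointwise convergence of the Fock transforms. Truncation makes
  their moduli increase with \<open>n\<close>, so the transform of the limit dominates each of them
  and inherits a weight bound from continuity.\<close>

lemma strongly_convergent_imp_fock_bound:
  assumes mart: "generalized_martingale P M \<Phi>" and conv: "strongly_convergent P M \<Phi>"
  shows "\<exists>C p. 0 \<le> C \<and> 0 \<le> p \<and>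
    (\<forall>\<sigma>\<in>Fin_Sets. \<forall>n. cmod (fock_transform M (\<Phi> n) \<sigma>) \<le> C * weight \<sigma> powr p)"
proof -
  obtain \<Psi> where \<Psi>: "\<Psi> \<in> S_dual P M" and lim: "limitin (strong_topology P M) \<Phi> \<Psi> sequentially"
    using conv by (auto simp: strongly_convergent_def)
  obtain K p where K: "0 \<le> K" "0 \<le> p" "\<And>\<xi>. \<xi> \<in> S_space P M \<Longrightarrow> cmod (\<Psi> \<xi>) \<le> K * p_norm P M p \<xi>"
    using S_dual_bound[OF \<Psi>] by blast
  have "cmod (fock_transform M (\<Phi> n) \<sigma>) \<le> K * weight \<sigma> powr p" if \<sigma>: "\<sigma> \<in> Fin_Sets" for \<sigma> n
  proof -
    \<comment> \<open>Uniform convergence on a singleton is convergence of one value of the Fock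
      transform.\<close>
    have "S_bounded P M {noise_prod M \<sigma>}"
      using noise_prod_in_S_space[OF \<sigma>] by (auto simp: S_bounded_def)
    then have "\<forall>\<^sub>F m in sequentially. dist (\<Phi> m (noise_prod M \<sigma>)) (\<Psi> (noise_prod M \<sigma>)) < \<epsilon>"
      if "0 < \<epsilon>" for \<epsilon>
      using lim that unfolding limitin_strong_topology_iff
      by (auto simp: dist_norm norm_minus_commute ennreal_less_iff elim!: allE[of _ "{noise_prod M \<sigma>}"] allE[of _ \<epsilon>] eventually_mono)
    then have "(\<lambda>m. fock_transform M (\<Phi> m) \<sigma>) \<longlonglongrightarrow> fock_transform M \<Psi> \<sigma>"
      unfolding fock_transform_def by (rule tendstoI)
    then have "(\<lambda>m. cmod (fock_transform M (\<Phi> m) \<sigma>)) \<longlonglongrightarrow> cmod (fock_transform M \<Psi> \<sigma>)"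
      by (rule tendsto_norm)
    moreover have "cmod (fock_transform M (\<Phi> n) \<sigma>) \<le> cmod (fock_transform M (\<Phi> m) \<sigma>)" if "n \<le> m" for m
      using generalized_martingale_fock[OF mart \<sigma> that] by (simp add: indicator_def)
    ultimately have "cmod (fock_transform M (\<Phi> n) \<sigma>) \<le> cmod (fock_transform M \<Psi> \<sigma>)"
      by (intro LIMSEQ_le_const) auto
    also have "\<dots> \<le> K * weight \<sigma> powr p"
      using K(3)[OF noise_prod_in_S_space[OF \<sigma>]] by (simp add: fock_transform_def p_norm_noise_prod[OF \<sigma>])
    finally show ?thesis .
  qed
  with K show ?thesis by blast
qed

lemma fock_bound_imp_strongly_convergent:
  assumes mart: "generalized_martingale P M \<Phi>" and p: "0 \<le> p" and C: "0 \<le> C"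
    and bound: "\<And>\<sigma> n. \<sigma> \<in> Fin_Sets \<Longrightarrow> cmod (fock_transform M (\<Phi> n) \<sigma>) \<le> C * weight \<sigma> powr p"
  shows "strongly_convergent P M \<Phi>"
proof -
  \<comment> \<open>The largest member of \<open>\<sigma>\<close> is the first index whose
    truncation keeps \<open>\<sigma>\<close>; from there on the transform at \<open>\<sigma>\<close>
    is constant. Inserting 0 covers the empty set.\<close>
  define F where "F \<sigma> = fock_transform M (\<Phi> (Max (insert 0 \<sigma>))) \<sigma>" for \<sigma>
  have dual: "\<Phi> n \<in> S_dual P M" for n
    using mart unfolding generalized_martingale_def by blast
  have F: "cmod (F \<sigma>) \<le> C * weight \<sigma> powr p" if "\<sigma> \<in> Fin_Sets" for \<sigma>
    unfolding F_def by (rule bound[OF that])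
  have fock: "fock_transform M (\<Phi> n) \<sigma> = (if \<sigma> \<subseteq> {0..n} then F \<sigma> else 0)" if \<sigma>: "\<sigma> \<in> Fin_Sets" for \<sigma> n
  proof (cases "\<sigma> \<subseteq> {0..n}")
    case True
    have fin: "finite (insert 0 \<sigma>)" using \<sigma> by (simp add: Fin_Sets_def)
    then have "Max (insert 0 \<sigma>) \<le> n" using True by (subst Max_le_iff) auto
    moreover have "\<sigma> \<subseteq> {0..Max (insert 0 \<sigma>)}" using fin by (auto intro: Max_ge)
    ultimately show ?thesis
      using generalized_martingale_fock[OF mart \<sigma>, of "Max (insert 0 \<sigma>)" n] True
      by (simp add: F_def del: Max_insert)
  next
    case False
    then show ?thesis using generalized_martingale_fock[OF mart \<sigma>, of n n] by (simp add: indicator_def)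
  qed
  define \<Psi> where "\<Psi> = restrict (\<lambda>\<xi>. \<Sum>\<^sub>\<infinity>\<sigma>\<in>Fin_Sets. coef \<sigma> \<xi> * F \<sigma>) (S_space P M)"
  note summ = coef_sum_bound(1)[OF _ order_refl F]
  let ?T = "\<lambda>A. \<Sum>\<^sub>\<infinity>\<sigma>\<in>A. (inverse (weight \<sigma>))\<^sup>2"
  have \<Psi>: "\<Psi> \<in> S_dual P M"
    unfolding \<Psi>_def
  proof (rule S_dual_of_bounded_linear[where p = "p + 1" and K = "C * sqrt (?T Fin_Sets)"])
    fix \<xi> \<eta> a b assume \<xi>\<eta>: "\<xi> \<in> S_space P M" "\<eta> \<in> S_space P M"
    have "(\<Sum>\<^sub>\<infinity>\<sigma>\<in>Fin_Sets. coef \<sigma> (\<lambda>\<omega>. a * \<xi> \<omega> + b * \<eta> \<omega>) * F \<sigma>) =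
        (\<Sum>\<^sub>\<infinity>\<sigma>\<in>Fin_Sets. a * (coef \<sigma> \<xi> * F \<sigma>) + b * (coef \<sigma> \<eta> * F \<sigma>))"
      by (rule infsum_cong) (use \<xi>\<eta> in \<open>simp add: coef_cmult_add S_space_L2 algebra_simps\<close>)
    also have "\<dots> = a * (\<Sum>\<^sub>\<infinity>\<sigma>\<in>Fin_Sets. coef \<sigma> \<xi> * F \<sigma>) + b * (\<Sum>\<^sub>\<infinity>\<sigma>\<in>Fin_Sets. coef \<sigma> \<eta> * F \<sigma>)"
      using summ[OF \<xi>\<eta>(1)] summ[OF \<xi>\<eta>(2)]
      by (simp add: infsum_add summable_on_cmult_right infsum_cmult_right)
    finally show "(\<Sum>\<^sub>\<infinity>\<sigma>\<in>Fin_Sets. coef \<sigma> (\<lambda>\<omega>. a * \<xi> \<omega> + b * \<eta> \<omega>) * F \<sigma>) = \<dots>" .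
  next
    fix \<xi> assume "\<xi> \<in> S_space P M"
    from coef_sum_bound(2)[OF this order_refl F]
    show "cmod (\<Sum>\<^sub>\<infinity>\<sigma>\<in>Fin_Sets. coef \<sigma> \<xi> * F \<sigma>) \<le> C * sqrt (?T Fin_Sets) * p_norm P M (p + 1) \<xi>"
      by (simp add: mult_ac)
  qed (use p in simp)
  have diff: "cmod (\<Psi> \<xi> - \<Phi> n \<xi>) \<le> C * p_norm P M (p + 1) \<xi> * sqrt (?T (Fin_Sets - Pow {0..n}))"
    if \<xi>: "\<xi> \<in> S_space P M" for \<xi> n
  proof -
    have "((\<lambda>\<sigma>. coef \<sigma> \<xi> * F \<sigma> - coef \<sigma> \<xi> * fock_transform M (\<Phi> n) \<sigma>) has_sum (\<Psi> \<xi> - \<Phi> n \<xi>)) Fin_Sets"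
      using has_sum_add[OF has_sum_infsum[OF summ[OF \<xi>]] has_sum_uminusI[OF S_dual_expansion[OF dual \<xi>]]] \<xi>
      by (simp add: \<Psi>_def)
    then have "\<Psi> \<xi> - \<Phi> n \<xi> = (\<Sum>\<^sub>\<infinity>\<sigma>\<in>Fin_Sets. coef \<sigma> \<xi> * F \<sigma> - coef \<sigma> \<xi> * fock_transform M (\<Phi> n) \<sigma>)"
      by (rule infsumI[symmetric])
    \<comment> \<open>On \<open>Pow {0..n}\<close> the two transforms agree and the terms cancel;
      outside it that of \<open>\<Phi> n\<close> is 0.\<close>
    also have "\<dots> = (\<Sum>\<^sub>\<infinity>\<sigma>\<in>Fin_Sets - Pow {0..n}. coef \<sigma> \<xi> * F \<sigma>)"
      by (rule infsum_cong_neutral) (auto simp: fock)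
    also have "cmod \<dots> \<le> C * p_norm P M (p + 1) \<xi> * sqrt (?T (Fin_Sets - Pow {0..n}))"
      by (rule coef_sum_bound(2)[OF \<xi>]) (auto intro: F)
    finally show ?thesis .
  qed
  \<comment> \<open>This factor does not depend on \<open>\<xi>\<close>, which makes the convergence
    uniform on sets bounded in the norm of order \<open>p + 1\<close>.\<close>
  have tail: "(\<lambda>n. sqrt (?T (Fin_Sets - Pow {0..n}))) \<longlonglongrightarrow> 0"
    using tendsto_real_sqrt[OF filterlim_compose[OF infsum_Diff_tendsto_0[OF weight_square_inverse_summable]
          Pow_filterlim_finite_subsets]] by simp
  have "limitin (strong_topology P M) \<Phi> \<Psi> sequentially"
    unfolding limitin_strong_topology_iff
  proof (intro conjI allI impI \<Psi>)
    fix B and \<epsilon> :: real assume B: "S_bounded P M B" and \<epsilon>: "0 < \<epsilon>"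
    obtain K where K: "\<And>\<xi>. \<xi> \<in> B \<Longrightarrow> p_norm P M (p + 1) \<xi> \<le> K" and sub: "B \<subseteq> S_space P M"
      using B p unfolding S_bounded_def by (metis add_nonneg_nonneg zero_le_one)
    have "(\<lambda>n. C * K * sqrt (?T (Fin_Sets - Pow {0..n}))) \<longlonglongrightarrow> C * K * 0"
      by (intro tendsto_mult tendsto_const tail)
    \<comment> \<open>Half of \<open>\<epsilon>\<close> leaves room for the supremum, which
      preserves only weak inequalities.\<close>
    then have "\<forall>\<^sub>F n in sequentially. C * K * sqrt (?T (Fin_Sets - Pow {0..n})) < \<epsilon> / 2"
      by (rule order_tendstoD) (use \<epsilon> in simp)
    then show "\<forall>\<^sub>F n in sequentially. \<Phi> n \<in> S_dual P M \<and>
        (SUP \<xi>\<in>B. ennreal (cmod (\<Psi> \<xi> - \<Phi> n \<xi>))) < ennreal \<epsilon>"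
    proof eventually_elim
      case (elim n)
      have "cmod (\<Psi> \<xi> - \<Phi> n \<xi>) \<le> \<epsilon> / 2" if "\<xi> \<in> B" for \<xi>
      proof -
        have "cmod (\<Psi> \<xi> - \<Phi> n \<xi>) \<le> C * p_norm P M (p + 1) \<xi> * sqrt (?T (Fin_Sets - Pow {0..n}))"
          using diff sub that by blast
        also have "\<dots> \<le> C * K * sqrt (?T (Fin_Sets - Pow {0..n}))"
          by (intro mult_right_mono mult_left_mono K that C) (simp add: infsum_nonneg)
        finally show ?thesis using elim by linarith
      qed
      then have "(SUP \<xi>\<in>B. ennreal (cmod (\<Psi> \<xi> - \<Phi> n \<xi>))) \<le> ennreal (\<epsilon> / 2)"
        by (intro SUP_least ennreal_leI)
      also have "\<dots> < ennreal \<epsilon>" using \<epsilon> by (simp add: ennreal_less_iff)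
      finally show ?case using dual by simp
    qed
  qed
  with \<Psi> show ?thesis unfolding strongly_convergent_def by blast
qed

end

theorem theorem4p2:
  fixes P :: "'a measure"
    and M :: "nat \<Rightarrow> 'a \<Rightarrow> real"
    and \<Phi> :: "nat \<Rightarrow> ('a \<Rightarrow> complex) \<Rightarrow> complex"
  assumes "prob_space P"
    and "normal_martingale P M"
    and "chaotic_representation P M"
    and "generalized_martingale P M \<Phi>"
  shows "strongly_convergent P M \<Phi> \<longleftrightarrow>
    (\<exists>C p :: real. 0 \<le> C \<and> 0 \<le> p \<and>
      (\<forall>\<sigma>\<in>Fin_Sets. (SUP n. ennreal (cmod (fock_transform M (\<Phi> n) \<sigma>))) \<le> ennreal (C * weight \<sigma> powr p)))"
proof -
  interpret normal_martingale_space P M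
    using assms by (simp add: normal_martingale_space_def normal_martingale_space_axioms_def)
  \<comment> \<open>With \<open>0 \<le> C\<close> the right-hand side is a nonnegative real, so the
    comparison in \<open>ennreal\<close> of the supremum is the real bound for every
    \<open>n\<close>.\<close>
  have SUP_iff: "(SUP n. ennreal (cmod (fock_transform M (\<Phi> n) \<sigma>))) \<le> ennreal (C * weight \<sigma> powr p) \<longleftrightarrow>
      (\<forall>n. cmod (fock_transform M (\<Phi> n) \<sigma>) \<le> C * weight \<sigma> powr p)" if "0 \<le> C" for C p \<sigma>
    using that by (simp add: SUP_le_iff ennreal_le_iff)
  show ?thesis
  proof
    assume "strongly_convergent P M \<Phi>"
    then show "\<exists>C p :: real. 0 \<le> C \<and> 0 \<le> p \<and> (\<forall>\<sigma>\<in>Fin_Sets.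
        (SUP n. ennreal (cmod (fock_transform M (\<Phi> n) \<sigma>))) \<le> ennreal (C * weight \<sigma> powr p))"
      using strongly_convergent_imp_fock_bound[OF assms(4)] SUP_iff by blast
  next
    assume "\<exists>C p :: real. 0 \<le> C \<and> 0 \<le> p \<and> (\<forall>\<sigma>\<in>Fin_Sets.
        (SUP n. ennreal (cmod (fock_transform M (\<Phi> n) \<sigma>))) \<le> ennreal (C * weight \<sigma> powr p))"
    then obtain C p :: real where "0 \<le> C" "0 \<le> p" and "\<forall>\<sigma>\<in>Fin_Sets.
        (SUP n. ennreal (cmod (fock_transform M (\<Phi> n) \<sigma>))) \<le> ennreal (C * weight \<sigma> powr p)"
      by blast
    with SUP_iff show "strongly_convergent P M \<Phi>"
      by (intro fock_bound_imp_strongly_convergent[OF assms(4), of p C]) blast+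
  qed
qed

end
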